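(* Suppose that there do not exist a positive integer $n$, a subring $B$ of $A=\mathbb{Z}[T_1,\dots,T_n]$ and an ideal $I$ of $B$ satisfying all four of the following conditions: a) $QF(B)=\mathbb{Q}(T_1,\dots,T_n)$, where $QF(B)$ denotes the quotient field of $B$ (taken inside $\mathbb{Q}(T_1,\dots,T_n)$); b) $IA=A$, where $IA$ is the ideal of $A$ generated by $I$; c) there is $\ell_0\in A^+$ such that for all $a\in A^+$, putting $\ell=\ell_0+a\in A$, the following holds: if $h(\ell)=0$ for some $h(X)\in B[X]$, then $h(X)\in I[X]$; d) $\mathbb{Q}\subset B/I$, i.e., $B/I$ contains (a copy of) the field $\mathbb{Q}$ as a subring. Then every semifield which is finitely generated as a semiring is additively idempotent.
   Context: A semiring $S(+,\cdot)$ is a set $S$ with addition $+$ and multiplication $\cdot$ that are both commutative and associative, and such that multiplication distributes over addition (no zero element is required). A semiring $S(+,\cdot)$ is a semifield if moreover $S(\cdot)$ is a group (so a semifield is not assumed to have a zero element, and all its elements are multiplicatively invertible). A semiring $S$ is additively idempotent if $a+a=a$ for all $a\in S$. A semifield is finitely generated as a semiring if it is generated by finitely many elements using only addition and multiplication. $A^+=\mathbb{N}[T_1,\dots,T_n]\subset A=\mathbb{Z}[T_1,\dots,T_n]$ denotes the semiring of nonzero polynomials with nonnegative integer coefficients. For an ideal $I$ of $B$, $I[X]$ denotes the set of polynomials in $B[X]$ all of whose coefficients lie in $I$. *)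

theory Defs
  imports
    "HOL-Library.Poly_Mapping"
    "HOL-Computational_Algebra.Polynomial"
    "HOL-Computational_Algebra.Fraction_Field"
    "HOL-Algebra.QuotRing"
    "HOL-Algebra.Subrings"
    "HOL-Algebra.Algebraic_Closure_Type"
begin

section \<open>Semirings and semifields without a zero\<close>

text \<open>
  Semirings are commutative and need not have a zero or a one, unlike the locale
  \<^locale>\<open>semiring\<close> of HOL-Algebra; hence the explicit carrier and operations.
\<close>

locale comm_semiring_on =
  fixes S :: "'a set"
    and sadd :: "'a \<Rightarrow> 'a \<Rightarrow> 'a"  (infixl "\<boxplus>" 65)
    and smul :: "'a \<Rightarrow> 'a \<Rightarrow> 'a"  (infixl "\<boxdot>" 70)
  assumes add_closed: "x \<in> S \<Longrightarrow> y \<in> S \<Longrightarrow> x \<boxplus> y \<in> S"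
    and mul_closed: "x \<in> S \<Longrightarrow> y \<in> S \<Longrightarrow> x \<boxdot> y \<in> S"
    and add_assoc: "x \<in> S \<Longrightarrow> y \<in> S \<Longrightarrow> z \<in> S \<Longrightarrow> (x \<boxplus> y) \<boxplus> z = x \<boxplus> (y \<boxplus> z)"
    and mul_assoc: "x \<in> S \<Longrightarrow> y \<in> S \<Longrightarrow> z \<in> S \<Longrightarrow> (x \<boxdot> y) \<boxdot> z = x \<boxdot> (y \<boxdot> z)"
    and add_commute: "x \<in> S \<Longrightarrow> y \<in> S \<Longrightarrow> x \<boxplus> y = y \<boxplus> x"
    and mul_commute: "x \<in> S \<Longrightarrow> y \<in> S \<Longrightarrow> x \<boxdot> y = y \<boxdot> x"
    and distrib: "x \<in> S \<Longrightarrow> y \<in> S \<Longrightarrow> z \<in> S \<Longrightarrow> x \<boxdot> (y \<boxplus> z) = (x \<boxdot> y) \<boxplus> (x \<boxdot> z)"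

locale semifield_on = comm_semiring_on +
  assumes mul_group: "\<exists>e. group \<lparr>carrier = S, monoid.mult = smul, one = e\<rparr>"

inductive_set semiring_span :: "('a \<Rightarrow> 'a \<Rightarrow> 'a) \<Rightarrow> ('a \<Rightarrow> 'a \<Rightarrow> 'a) \<Rightarrow> 'a set \<Rightarrow> 'a set"
  for sadd smul :: "'a \<Rightarrow> 'a \<Rightarrow> 'a" and F :: "'a set"
  where
    base: "x \<in> F \<Longrightarrow> x \<in> semiring_span sadd smul F"
  | add: "x \<in> semiring_span sadd smul F \<Longrightarrow> y \<in> semiring_span sadd smul F
            \<Longrightarrow> sadd x y \<in> semiring_span sadd smul F"
  | mul: "x \<in> semiring_span sadd smul F \<Longrightarrow> y \<in> semiring_span sadd smul F
            \<Longrightarrow> smul x y \<in> semiring_span sadd smul F"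

definition finitely_generated_semiring ::
    "'a set \<Rightarrow> ('a \<Rightarrow> 'a \<Rightarrow> 'a) \<Rightarrow> ('a \<Rightarrow> 'a \<Rightarrow> 'a) \<Rightarrow> bool" where
  "finitely_generated_semiring S sadd smul \<longleftrightarrow>
     (\<exists>F. finite F \<and> F \<subseteq> S \<and> semiring_span sadd smul F = S)"

definition additively_idempotent :: "'a set \<Rightarrow> ('a \<Rightarrow> 'a \<Rightarrow> 'a) \<Rightarrow> bool" where
  "additively_idempotent S sadd \<longleftrightarrow> (\<forall>a\<in>S. sadd a a = a)"

section \<open>The polynomial rings \<open>\<int>[T\<^sub>1, \<dots>, T\<^sub>n]\<close>\<close>

text \<open>
  The number of variables is bound inside the theorem, so it cannot be the size of an index type.
  We work in the integral domain of polynomials in countably many variables, indexed by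
  \<^typ>\<open>nat\<close>: a monomial is its exponent function \<^typ>\<open>nat \<Rightarrow>\<^sub>0 nat\<close>, and a polynomial maps monomials
  to coefficients. The variables \<open>T\<^sub>1, \<dots>, T\<^sub>n\<close> are those with index \<open>0, \<dots>, n - 1\<close>.
\<close>

type_synonym int_mpoly = "(nat \<Rightarrow>\<^sub>0 nat) \<Rightarrow>\<^sub>0 int"

definition int_polys :: "nat \<Rightarrow> int_mpoly set" where
  "int_polys n = {p. \<forall>m\<in>Poly_Mapping.keys p. Poly_Mapping.keys m \<subseteq> {..<n}}"

definition int_poly_ring :: "nat \<Rightarrow> int_mpoly ring" where
  "int_poly_ring n = ring_of_type_algebra\<lparr>carrier := int_polys n\<rparr>"

text \<open>The zero polynomial is excluded.\<close>

definition pos_polys :: "nat \<Rightarrow> int_mpoly set" where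
  "pos_polys n = {p \<in> int_polys n. p \<noteq> 0 \<and> (\<forall>m. Poly_Mapping.lookup p m \<ge> 0)}"

definition quotient_field :: "'a::idom set \<Rightarrow> 'a fract set" where
  "quotient_field B = {Fract b c | b c. b \<in> B \<and> c \<in> B \<and> c \<noteq> 0}"

text \<open>
  \<open>\<rat>(T\<^sub>1, \<dots>, T\<^sub>n)\<close>: clearing denominators, every rational function over \<open>\<rat>\<close> is a quotient of
  polynomials with integer coefficients.
\<close>

definition rational_functions :: "nat \<Rightarrow> int_mpoly fract set" where
  "rational_functions n = quotient_field (int_polys n)"

text \<open>\<open>C[X]\<close>, for \<open>C\<close> a subring \<open>B\<close> or an ideal \<open>I\<close> of \<open>B\<close>.\<close>

definition polys_over :: "'a::zero set \<Rightarrow> 'a poly set" where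
  "polys_over C = {h. \<forall>i. coeff h i \<in> C}"

text \<open>
  \<^term>\<open>ring_hom\<close> preserves the unit, so the copy of \<open>\<rat>\<close> in the target is a unital subring.
\<close>

definition contains_rationals :: "('a, 'b) ring_scheme \<Rightarrow> bool" where
  "contains_rationals R \<longleftrightarrow>
     (\<exists>f. f \<in> ring_hom (ring_of_type_algebra :: rat ring) R \<and> inj_on f UNIV)"

end

theory Submission
  imports Defs Complex_Main "HOL-Library.Multiset_Order" "HOL-Computational_Algebra.Primes"
begin

text \<open>
  The conclusion holds because a finitely generated nonzero commutative ring cannot contain \<open>\<rat>\<close>:
  a semifield with \<open>1 + 1 \<noteq> 1\<close> that is finitely generated as a semiring would produce such a ring.

  Adjoin a zero to the semifield and write it as the quotient of a free commutative semiring by a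
  congruence. If \<open>1 + 1\<close> and \<open>1\<close> are not congruent, Zorn's lemma enlarges the congruence to one that is
  maximal with this property (\<open>exists_maximal_congruence\<close>); the quotient remains a finitely generated
  semifield with zero, and every strictly larger congruence makes addition idempotent. Order it by
  \<open>x \<preceq> y\<close> iff \<open>x + c = y\<close> for some \<open>c\<close>. Two explicit congruences and maximality show that every element
  \<open>x\<close> is infinitesimal (\<open>1 + x = 1\<close>), infinite (\<open>x + 1 = x\<close>), or bounded from above and from below by
  positive rationals (\<open>trichotomy\<close>).

  Let \<open>R\<close> be the ring of differences of the bounded elements. It is not zero, because \<open>n + 1 = n\<close> fails
  for all natural numbers \<open>n\<close>, and it contains \<open>1/p\<close> for every prime \<open>p\<close>. A bounded element is a sum of
  monomials in the generators, none of them infinite; since infinitesimals vanish in \<open>R\<close>, the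
  monomials \<open>x\<^sup>a\<close> that are bounded on both sides span \<open>R\<close> over \<open>\<int>\<close>. Their exponents \<open>a\<close> form a submonoid
  \<open>M\<close> of \<open>\<nat>\<^sup>n\<close> with \<open>b - a \<in> M\<close> whenever \<open>a \<le> b\<close> lie in \<open>M\<close>. Hence \<open>R = \<int>[M] / J\<close> for an ideal \<open>J\<close>
  containing no nonzero integer, and Dickson's lemma gives \<open>J\<close> a finite Groebner basis. Division by that
  basis needs only the inverses of its leading coefficients, so all but finitely many primes stay
  non-invertible in \<open>R\<close> (\<open>finitely_many_primes_invertible\<close>). This contradicts \<open>1/p \<in> R\<close>.
\<close>

section \<open>Semifield congruences\<close>

definition semiring_congruence :: "('r::comm_semiring_1 \<Rightarrow> 'r \<Rightarrow> bool) \<Rightarrow> bool" where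
  "semiring_congruence E \<longleftrightarrow> equivp E \<and> (\<forall>x y z. E x y \<longrightarrow> E (x + z) (y + z) \<and> E (x * z) (y * z))"

lemma semiring_congruenceI:
  assumes "\<And>x. E x x" "\<And>x y. E x y \<Longrightarrow> E y x" "\<And>x y z. E x y \<Longrightarrow> E y z \<Longrightarrow> E x z"
    and "\<And>x y z. E x y \<Longrightarrow> E (x + z) (y + z)" "\<And>x y z. E x y \<Longrightarrow> E (x * z) (y * z)"
  shows "semiring_congruence E"
  unfolding semiring_congruence_def
  using assms by (intro conjI equivpI reflpI sympI transpI allI impI) metis+

text \<open>
  These are the congruences whose quotient is a semifield with a zero adjoined (a sum
  vanishes only if its summands do) in which addition is not idempotent. Reasoning modulo the congruence
  instead of passing to the quotient keeps the type fixed while the congruence is enlarged.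
\<close>

locale semifield_congruence =
  fixes eq :: "'r::comm_semiring_1 \<Rightarrow> 'r \<Rightarrow> bool"  (infix "\<doteq>" 50)
  assumes congruence: "semiring_congruence eq"
    and invertible: "\<not> x \<doteq> 0 \<Longrightarrow> \<exists>y. x * y \<doteq> 1"
    and zerosumfree: "x + y \<doteq> 0 \<Longrightarrow> x \<doteq> 0"
    and not_idempotent: "\<not> 1 + 1 \<doteq> 1"
begin

lemma eq_refl [simp, intro]: "x \<doteq> x"
  and eq_sym: "x \<doteq> y \<Longrightarrow> y \<doteq> x"
  and eq_trans [trans]: "x \<doteq> y \<Longrightarrow> y \<doteq> z \<Longrightarrow> x \<doteq> z"
  using congruence unfolding semiring_congruence_def by (meson equivp_reflp equivp_symp equivp_transp)+

lemma add_eq: "x \<doteq> y \<Longrightarrow> x' \<doteq> y' \<Longrightarrow> x + x' \<doteq> y + y'"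
proof -
  have *: "a \<doteq> b \<Longrightarrow> a + c \<doteq> b + c" for a b c
    using congruence unfolding semiring_congruence_def by blast
  assume "x \<doteq> y" "x' \<doteq> y'"
  then show ?thesis
    using *[of x y x'] *[of x' y' y] by (metis add.commute eq_trans)
qed

lemma mult_eq: "x \<doteq> y \<Longrightarrow> x' \<doteq> y' \<Longrightarrow> x * x' \<doteq> y * y'"
proof -
  have *: "a \<doteq> b \<Longrightarrow> a * c \<doteq> b * c" for a b c
    using congruence unfolding semiring_congruence_def by blast
  assume "x \<doteq> y" "x' \<doteq> y'"
  then show ?thesis
    using *[of x y x'] *[of x' y' y] by (metis mult.commute eq_trans)
qed

lemma mult_right_cancel:
  assumes "x * z \<doteq> y * z" "\<not> z \<doteq> 0"
  shows "x \<doteq> y"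
proof -
  obtain w where w: "z * w \<doteq> 1"
    using invertible assms(2) by blast
  have *: "a \<doteq> a * z * w" for a
    using mult_eq[OF eq_refl eq_sym[OF w], of a] by (simp add: mult.assoc)
  show ?thesis
    using *[of x] *[of y] mult_eq[OF assms(1) eq_refl, of w] by (meson eq_sym eq_trans)
qed

lemma one_neq_zero: "\<not> 1 \<doteq> 0"
  using add_eq[OF eq_refl, of 1 0 1] not_idempotent by auto

lemma mult_nonzero: "\<not> x \<doteq> 0 \<Longrightarrow> \<not> y \<doteq> 0 \<Longrightarrow> \<not> x * y \<doteq> 0"
  using mult_right_cancel[of x y 0] by auto

lemma of_nat_nonzero: "n > 0 \<Longrightarrow> \<not> of_nat n \<doteq> 0"
  using zerosumfree[of 1 "of_nat (n - 1)"] one_neq_zero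
  by (metis Suc_pred' of_nat_Suc)

text \<open>
  This is what makes the order antisymmetric. Multiply \<open>a + (b + c) = a\<close> by \<open>b\<close> and add \<open>a c\<close>: the result is
  \<open>(a + b) (b + c) = a (b + c)\<close>, from which \<open>b + c\<close> can be cancelled.
\<close>

lemma absorb_summand:
  assumes "a + (b + c) \<doteq> a"
  shows "a + b \<doteq> a"
proof (cases "b + c \<doteq> 0")
  case True
  then show ?thesis
    using add_eq[OF eq_refl zerosumfree[OF True], of a] by simp
next
  case False
  have "(a + (b + c)) * b + a * c \<doteq> a * b + a * c"
    by (rule add_eq[OF mult_eq[OF assms eq_refl] eq_refl])
  then have "(a + b) * (b + c) \<doteq> a * (b + c)"
    by (simp add: algebra_simps)
  with False show ?thesis
    by (rule mult_right_cancel[rotated])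
qed

lemma absorb_multiple:
  assumes "a + b \<doteq> a"
  shows "a + of_nat n * b \<doteq> a"
proof (induction n)
  case (Suc n)
  have "a + of_nat (Suc n) * b = (a + of_nat n * b) + b"
    by (simp add: algebra_simps)
  also have "\<dots> \<doteq> a + b"
    by (rule add_eq[OF Suc.IH eq_refl])
  finally show ?case
    using assms by (rule eq_trans)
qed simp

text \<open>
  If \<open>n + 1 = n\<close>, adding \<open>1\<close> repeatedly gives \<open>n + n = n\<close>, which divided by \<open>n\<close> makes addition idempotent.
  The successor is used in place of \<open>n\<close> because \<open>0\<close> cannot be cancelled.
\<close>

lemma not_absorb_one: "\<not> of_nat n + 1 \<doteq> of_nat n"
proof
  assume "of_nat n + 1 \<doteq> of_nat n"
  then have "of_nat (Suc n) + 1 \<doteq> of_nat (Suc n)"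
    using add_eq[OF _ eq_refl, of "of_nat n + 1" "of_nat n" 1] by (simp add: ac_simps)
  then have "of_nat (Suc n) + of_nat (Suc n) * 1 \<doteq> of_nat (Suc n)"
    by (rule absorb_multiple)
  then have "(1 + 1) * of_nat (Suc n) \<doteq> 1 * of_nat (Suc n)"
    by (simp only: distrib_right mult_1_left mult_1_right)
  then have "1 + 1 \<doteq> 1"
    by (rule mult_right_cancel) (rule of_nat_nonzero, simp)
  with not_idempotent show False ..
qed

definition le :: "'r \<Rightarrow> 'r \<Rightarrow> bool"  (infix "\<preceq>" 50) where
  "x \<preceq> y \<longleftrightarrow> (\<exists>c. x + c \<doteq> y)"

lemma le_refl [simp, intro]: "x \<preceq> x"
  unfolding le_def by (rule exI[of _ 0]) simp

lemma eq_imp_le: "x \<doteq> y \<Longrightarrow> x \<preceq> y"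
  unfolding le_def by (rule exI[of _ 0]) simp

lemma le_add: "x \<preceq> x + y" "x \<preceq> y + x"
  unfolding le_def by (rule exI[of _ y], simp add: add.commute)+

lemma le_trans [trans]:
  assumes "x \<preceq> y" "y \<preceq> z" shows "x \<preceq> z"
proof -
  obtain c d where "x + c \<doteq> y" "y + d \<doteq> z"
    using assms unfolding le_def by blast
  then have "x + (c + d) \<doteq> z"
    using add_eq[of "x + c" y d d] eq_trans by (fastforce simp: ac_simps)
  then show ?thesis
    unfolding le_def by blast
qed

lemma eq_le_trans [trans]: "x \<doteq> y \<Longrightarrow> y \<preceq> z \<Longrightarrow> x \<preceq> z"
  and le_eq_trans [trans]: "x \<preceq> y \<Longrightarrow> y \<doteq> z \<Longrightarrow> x \<preceq> z"
  by (meson eq_imp_le le_trans)+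

lemma add_le: 
  assumes "x \<preceq> y" "x' \<preceq> y'" shows "x + x' \<preceq> y + y'"
proof -
  obtain c d where "x + c \<doteq> y" "x' + d \<doteq> y'"
    using assms unfolding le_def by blast
  from add_eq[OF this] have "(x + x') + (c + d) \<doteq> y + y'"
    by (simp add: ac_simps)
  then show ?thesis
    unfolding le_def by blast
qed

lemma mult_right_le: 
  assumes "x \<preceq> y" shows "x * z \<preceq> y * z"
proof -
  obtain c where "x + c \<doteq> y"
    using assms unfolding le_def by blast
  from mult_eq[OF this eq_refl, of z] have "x * z + c * z \<doteq> y * z"
    by (simp add: algebra_simps)
  then show ?thesis
    unfolding le_def by blast
qed

lemma mult_le: "x \<preceq> y \<Longrightarrow> x' \<preceq> y' \<Longrightarrow> x * x' \<preceq> y * y'"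
  using mult_right_le[of x y x'] mult_right_le[of x' y' y] le_trans by (simp add: mult.commute)

lemma absorb_le:
  assumes "a + b \<doteq> a" "x \<preceq> of_nat n * b"
  shows "a + x \<doteq> a"
proof -
  obtain c where c: "x + c \<doteq> of_nat n * b"
    using assms(2) unfolding le_def by blast
  have "a + (x + c) \<doteq> a"
    using add_eq[OF eq_refl c] absorb_multiple[OF assms(1)] by (rule eq_trans)
  then show ?thesis
    by (rule absorb_summand)
qed

lemma not_Suc_le: "\<not> of_nat n + 1 \<preceq> of_nat n"
proof
  assume "of_nat n + 1 \<preceq> of_nat n"
  then obtain c where "of_nat n + (1 + c) \<doteq> of_nat n"
    unfolding le_def add.assoc by blast
  then show False
    using absorb_summand not_absorb_one by blast
qed

definition bounded_above :: "'r \<Rightarrow> bool" where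
  "bounded_above x \<longleftrightarrow> (\<exists>n. x \<preceq> of_nat n)"

definition bounded_below :: "'r \<Rightarrow> bool" where
  "bounded_below x \<longleftrightarrow> (\<exists>n. 1 \<preceq> of_nat n * x)"

lemma bounded_above_le: "x \<preceq> y \<Longrightarrow> bounded_above y \<Longrightarrow> bounded_above x"
  unfolding bounded_above_def by (meson le_trans)

lemma bounded_above_of_nat [simp]: "bounded_above (of_nat n)"
  unfolding bounded_above_def by blast

lemma bounded_above_0 [simp]: "bounded_above 0" and bounded_above_1 [simp]: "bounded_above 1"
  using bounded_above_of_nat[of 0] bounded_above_of_nat[of 1] by simp_all

lemma bounded_above_add: "bounded_above x \<Longrightarrow> bounded_above y \<Longrightarrow> bounded_above (x + y)"
  unfolding bounded_above_def by (metis add_le of_nat_add)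

lemma bounded_above_mult: "bounded_above x \<Longrightarrow> bounded_above y \<Longrightarrow> bounded_above (x * y)"
  unfolding bounded_above_def by (metis mult_le of_nat_mult)

text \<open>
  On bounded elements this is equality in their ring of differences: if \<open>c + x = c + y\<close> with \<open>c\<close> bounded,
  then \<open>c\<close> can be completed to a natural number.
\<close>

definition stably_eq :: "'r \<Rightarrow> 'r \<Rightarrow> bool"  (infix "\<asymp>" 50) where
  "x \<asymp> y \<longleftrightarrow> (\<exists>n. of_nat n + x \<doteq> of_nat n + y)"

lemma eq_imp_stably_eq: "x \<doteq> y \<Longrightarrow> x \<asymp> y"
  unfolding stably_eq_def using add_eq by blast

lemma stably_eq_refl [simp, intro]: "x \<asymp> x"
  by (simp add: eq_imp_stably_eq)

lemma stably_eq_sym: "x \<asymp> y \<Longrightarrow> y \<asymp> x"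
  unfolding stably_eq_def using eq_sym by blast

lemma stably_eqI:
  assumes "bounded_above c" "c + x \<doteq> c + y"
  shows "x \<asymp> y"
proof -
  obtain n d where d: "c + d \<doteq> of_nat n"
    using assms(1) unfolding bounded_above_def le_def by blast
  have *: "of_nat n + z \<doteq> d + (c + z)" for z
    using add_eq[OF eq_sym[OF d] eq_refl, of z] by (simp add: ac_simps)
  have "of_nat n + x \<doteq> of_nat n + y"
    using *[of x] *[of y] add_eq[OF eq_refl assms(2), of d] by (meson eq_sym eq_trans)
  then show ?thesis
    unfolding stably_eq_def by blast
qed

lemma stably_eq_add:
  assumes "x \<asymp> y" "x' \<asymp> y'" shows "x + x' \<asymp> y + y'"
proof -
  obtain n m where "of_nat n + x \<doteq> of_nat n + y" "of_nat m + x' \<doteq> of_nat m + y'"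
    using assms unfolding stably_eq_def by blast
  from add_eq[OF this] have "of_nat (n + m) + (x + x') \<doteq> of_nat (n + m) + (y + y')"
    by (simp add: ac_simps)
  then show ?thesis
    unfolding stably_eq_def by blast
qed

lemma stably_eq_trans [trans]:
  assumes "x \<asymp> y" "y \<asymp> z" shows "x \<asymp> z"
proof -
  obtain n m where n: "of_nat n + x \<doteq> of_nat n + y" and m: "of_nat m + y \<doteq> of_nat m + z"
    using assms unfolding stably_eq_def by blast
  have "of_nat (n + m) + x = of_nat m + (of_nat n + x)"
    by (simp add: ac_simps)
  also have "\<dots> \<doteq> of_nat m + (of_nat n + y)"
    by (rule add_eq[OF eq_refl n])
  also have "\<dots> = of_nat n + (of_nat m + y)"
    by (simp add: ac_simps)
  also have "\<dots> \<doteq> of_nat n + (of_nat m + z)"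
    by (rule add_eq[OF eq_refl m])
  also have "\<dots> = of_nat (n + m) + z"
    by (simp add: ac_simps)
  finally show ?thesis
    unfolding stably_eq_def by blast
qed

lemma stably_eq_mult_right:
  assumes "x \<asymp> y" "bounded_above z" shows "x * z \<asymp> y * z"
proof -
  obtain n where "of_nat n + x \<doteq> of_nat n + y"
    using assms unfolding stably_eq_def by blast
  from mult_eq[OF this eq_refl, of z]
  have "of_nat n * z + x * z \<doteq> of_nat n * z + y * z"
    by (simp add: algebra_simps)
  then show ?thesis
    by (rule stably_eqI[rotated]) (simp add: bounded_above_mult assms(2))
qed

lemma stably_eq_cancel_left:
  assumes "bounded_above c" "c + x \<asymp> c + y" shows "x \<asymp> y"
proof -
  obtain n where "(of_nat n + c) + x \<doteq> (of_nat n + c) + y"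
    using assms unfolding stably_eq_def by (auto simp: ac_simps)
  then show ?thesis
    by (rule stably_eqI[rotated]) (simp add: bounded_above_add assms(1))
qed

lemma of_nat_stably_eq_iff [simp]: "of_nat m \<asymp> of_nat n \<longleftrightarrow> m = n"
proof
  have *: False if mn: "of_nat m \<asymp> of_nat n" "m < n" for m n
  proof -
    define j where "j = n - Suc m"
    have n: "n = m + Suc j"
      using mn(2) unfolding j_def by arith
    obtain k where "of_nat k + of_nat n \<doteq> of_nat k + of_nat m"
      using mn(1) eq_sym unfolding stably_eq_def by blast
    then have "of_nat (k + m) + (1 + of_nat j) \<doteq> of_nat (k + m)"
      unfolding n of_nat_add of_nat_Suc by (simp only: add.assoc)
    then show False
      using absorb_summand not_absorb_one by blast
  qed
  show "m = n" if "of_nat m \<asymp> of_nat n"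
    using * that stably_eq_sym by (metis linorder_neqE_nat)
qed auto

text \<open>
  Read in the ring of differences, where \<open>n\<close> cancels, this says that \<open>x\<close> is at least \<open>1/k\<close>. In the semiring
  itself it is a priori weaker than \<open>bounded_below\<close>.
\<close>

definition stably_pos :: "'r \<Rightarrow> bool" where
  "stably_pos x \<longleftrightarrow> (\<exists>n k. of_nat n + 1 \<preceq> of_nat n + of_nat k * x)"

lemma stably_pos_1 [simp]: "stably_pos 1"
  unfolding stably_pos_def by (rule exI[of _ 0], rule exI[of _ 1]) simp

lemma stably_pos_nonzero: 
  assumes "stably_pos x" shows "\<not> x \<doteq> 0"
proof
  assume x: "x \<doteq> 0"
  obtain n k where "of_nat n + 1 \<preceq> of_nat n + of_nat k * x"
    using assms unfolding stably_pos_def by blast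
  also have "\<dots> \<doteq> of_nat n + of_nat k * 0"
    by (intro add_eq mult_eq eq_refl x)
  finally show False
    using not_Suc_le by simp
qed

lemma stably_pos_cong:
  assumes "stably_pos x" "x \<asymp> y" shows "stably_pos y"
proof -
  obtain n k where 1: "of_nat n + 1 \<preceq> of_nat n + of_nat k * x"
    using assms unfolding stably_pos_def by blast
  have "of_nat k * x \<asymp> of_nat k * y"
    using stably_eq_mult_right[OF assms(2), of "of_nat k"] by (simp add: mult.commute)
  then obtain m where 2: "of_nat m + of_nat k * x \<doteq> of_nat m + of_nat k * y"
    unfolding stably_eq_def by blast
  have "of_nat (m + n) + 1 = of_nat m + (of_nat n + 1)"
    by (simp add: ac_simps)
  also have "\<dots> \<preceq> of_nat m + (of_nat n + of_nat k * x)"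
    by (rule add_le[OF le_refl 1])
  also have "\<dots> = of_nat n + (of_nat m + of_nat k * x)"
    by (simp add: ac_simps)
  also have "\<dots> \<doteq> of_nat n + (of_nat m + of_nat k * y)"
    by (rule add_eq[OF eq_refl 2])
  also have "\<dots> = of_nat (m + n) + of_nat k * y"
    by (simp add: ac_simps)
  finally show ?thesis
    unfolding stably_pos_def by blast
qed

text \<open>
  In the ring of differences one multiplies \<open>1 \<le> j y\<close> by \<open>k x \<ge> 1\<close>. Without cancellation the surplus
  \<open>m k x\<close> has to be completed to a natural number \<open>l\<close> by some \<open>d\<close>; this is where \<open>x\<close> must be bounded.
\<close>

lemma stably_pos_mult:
  assumes "stably_pos x" "stably_pos y" "bounded_above x"
  shows "stably_pos (x * y)"
proof -
  obtain n k where x: "of_nat n + 1 \<preceq> of_nat n + of_nat k * x"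
    using assms(1) unfolding stably_pos_def by blast
  obtain m j where y: "of_nat m + 1 \<preceq> of_nat m + of_nat j * y"
    using assms(2) unfolding stably_pos_def by blast
  have "bounded_above (of_nat m * (of_nat k * x))"
    by (intro bounded_above_mult bounded_above_of_nat assms)
  then obtain l d where d: "of_nat m * (of_nat k * x) + d \<doteq> of_nat l"
    unfolding bounded_above_def le_def by blast
  have "of_nat (l + n) + 1 = of_nat l + (of_nat n + 1)"
    by (simp add: ac_simps)
  also have "\<dots> \<preceq> of_nat l + (of_nat n + of_nat k * x)"
    by (rule add_le[OF le_refl x])
  also have "\<dots> \<doteq> (of_nat m * (of_nat k * x) + d) + (of_nat n + of_nat k * x)"
    by (rule add_eq[OF eq_sym[OF d] eq_refl])
  also have "\<dots> = (of_nat m + 1) * (of_nat k * x) + (d + of_nat n)"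
    by (simp add: algebra_simps)
  also have "\<dots> \<preceq> (of_nat m + of_nat j * y) * (of_nat k * x) + (d + of_nat n)"
    by (intro add_le mult_right_le y le_refl)
  also have "\<dots> = (of_nat m * (of_nat k * x) + d) + (of_nat n + of_nat (k * j) * (x * y))"
    by (simp add: algebra_simps)
  also have "\<dots> \<doteq> of_nat l + (of_nat n + of_nat (k * j) * (x * y))"
    by (rule add_eq[OF d eq_refl])
  also have "\<dots> = of_nat (l + n) + of_nat (k * j) * (x * y)"
    by (simp add: ac_simps)
  finally show ?thesis
    unfolding stably_pos_def by blast
qed

lemma bounded_below_mult:
  assumes "bounded_below x" "bounded_below y" shows "bounded_below (x * y)"
proof -
  obtain n m where "1 \<preceq> of_nat n * x" "1 \<preceq> of_nat m * y"
    using assms unfolding bounded_below_def by blast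
  from mult_le[OF this] have "1 \<preceq> of_nat (n * m) * (x * y)"
    by (simp add: ac_simps)
  then show ?thesis
    unfolding bounded_below_def by blast
qed

lemma bounded_above_factor:
  assumes "bounded_above (x * y)" "bounded_below x" shows "bounded_above y"
proof -
  obtain n where "1 \<preceq> of_nat n * x"
    using assms(2) unfolding bounded_below_def by blast
  from mult_right_le[OF this, of y] have "y \<preceq> of_nat n * (x * y)"
    by (simp add: mult.assoc)
  then show ?thesis
    by (rule bounded_above_le) (simp add: bounded_above_mult assms(1))
qed

lemma bounded_below_factor:
  assumes "bounded_below (x * y)" "bounded_above x" shows "bounded_below y"
proof -
  obtain n m where n: "1 \<preceq> of_nat n * (x * y)" and m: "x \<preceq> of_nat m"
    using assms unfolding bounded_below_def bounded_above_def by blast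
  have "of_nat n * (x * y) \<preceq> of_nat n * (of_nat m * y)"
    by (intro mult_le le_refl m)
  with n have "1 \<preceq> of_nat (n * m) * y"
    using le_trans by (simp add: mult.assoc)
  then show ?thesis
    unfolding bounded_below_def by blast
qed

end

section \<open>Maximal congruences\<close>

locale maximal_semifield_congruence = semifield_congruence +
  assumes maximal: "semiring_congruence E \<Longrightarrow> (\<And>x y. x \<doteq> y \<Longrightarrow> E x y) \<Longrightarrow> \<not> E (1 + 1) 1 \<Longrightarrow> E x y \<Longrightarrow> x \<doteq> y"
begin

text \<open>
  Identifying \<open>x\<close> and \<open>y\<close> when each is at most \<open>1 + k s\<close> times the other is a congruence: transitivity holds
  because \<open>s\<^sup>2 \<preceq> s\<close>. It identifies \<open>1 + s\<close> with \<open>1\<close>. By maximality it is either contained in the given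
  congruence, or it identifies \<open>1 + 1\<close> with \<open>1\<close>.
\<close>

lemma absorbed_or_two_le:
  assumes "s \<preceq> 1"
  shows "1 + s \<doteq> 1 \<or> (\<exists>k. 1 + 1 \<preceq> 1 + of_nat k * s)"
proof (rule disjCI)
  define G where "G x y \<longleftrightarrow> (\<exists>k. x \<preceq> (1 + of_nat k * s) * y \<and> y \<preceq> (1 + of_nat k * s) * x)" for x y
  assume "\<nexists>k. 1 + 1 \<preceq> 1 + of_nat k * s"
  then have proper: "\<not> G (1 + 1) 1"
    unfolding G_def by simp
  have ss: "s * s \<preceq> s"
    using mult_right_le[OF assms, of s] by simp
  have one_le: "x \<preceq> (1 + of_nat k * s) * x" for k x
    using le_add(1)[of x "of_nat k * s * x"] by (simp add: algebra_simps)
  have "semiring_congruence G"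
  proof (rule semiring_congruenceI)
    show "G x x" for x
      unfolding G_def using one_le by blast
    show "G x y \<Longrightarrow> G y x" for x y
      unfolding G_def by blast
    show "G x z" if xy: "G x y" and yz: "G y z" for x y z
    proof -
      obtain k where k: "x \<preceq> (1 + of_nat k * s) * y" "y \<preceq> (1 + of_nat k * s) * x"
        using xy unfolding G_def by blast
      obtain j where j: "y \<preceq> (1 + of_nat j * s) * z" "z \<preceq> (1 + of_nat j * s) * y"
        using yz unfolding G_def by blast
      have prod: "(1 + of_nat k * s) * (1 + of_nat j * s) \<preceq> 1 + of_nat (k + j + k * j) * s"
      proof -
        have "(1 + of_nat k * s) * (1 + of_nat j * s)
            = (1 + of_nat (k + j) * s) + s * s * of_nat (k * j)"
          by (simp add: algebra_simps)
        also have "\<dots> \<preceq> (1 + of_nat (k + j) * s) + s * of_nat (k * j)"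
          by (intro add_le le_refl mult_right_le ss)
        also have "\<dots> = 1 + of_nat (k + j + k * j) * s"
          by (simp add: algebra_simps)
        finally show ?thesis .
      qed
      have "x \<preceq> (1 + of_nat k * s) * y" by (rule k)
      also have "\<dots> \<preceq> (1 + of_nat k * s) * ((1 + of_nat j * s) * z)"
        by (rule mult_le[OF le_refl j(1)])
      also have "\<dots> = (1 + of_nat k * s) * (1 + of_nat j * s) * z"
        by (simp add: mult.assoc)
      also have "\<dots> \<preceq> (1 + of_nat (k + j + k * j) * s) * z"
        by (rule mult_right_le[OF prod])
      finally have 1: "x \<preceq> (1 + of_nat (k + j + k * j) * s) * z" .
      have "z \<preceq> (1 + of_nat j * s) * y" by (rule j)
      also have "\<dots> \<preceq> (1 + of_nat j * s) * ((1 + of_nat k * s) * x)"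
        by (rule mult_le[OF le_refl k(2)])
      also have "\<dots> = (1 + of_nat k * s) * (1 + of_nat j * s) * x"
        by (simp add: ac_simps)
      also have "\<dots> \<preceq> (1 + of_nat (k + j + k * j) * s) * x"
        by (rule mult_right_le[OF prod])
      finally show ?thesis
        unfolding G_def using 1 by blast
    qed
    show "G (x + z) (y + z)" if xy: "G x y" for x y z
    proof -
      obtain k where k: "x \<preceq> (1 + of_nat k * s) * y" "y \<preceq> (1 + of_nat k * s) * x"
        using xy unfolding G_def by blast
      show ?thesis
        using add_le[OF k(1) one_le[of z k]] add_le[OF k(2) one_le[of z k]]
        unfolding G_def by (auto simp: distrib_left)
    qed
    show "G (x * z) (y * z)" if xy: "G x y" for x y z
    proof -
      obtain k where k: "x \<preceq> (1 + of_nat k * s) * y" "y \<preceq> (1 + of_nat k * s) * x"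
        using xy unfolding G_def by blast
      show ?thesis
        using k[THEN mult_right_le, of z] unfolding G_def by (auto simp: mult.assoc)
    qed
  qed
  moreover have "G x y" if "x \<doteq> y" for x y
    unfolding G_def using that by (intro exI[of _ 0]) (simp add: eq_imp_le eq_sym)
  moreover have "G (1 + s) 1"
    unfolding G_def using le_trans[OF le_add(1)[of 1 s] one_le[of "1 + s" 1]] by (intro exI[of _ 1]) simp
  ultimately show "1 + s \<doteq> 1"
    using maximal proper by blast
qed

text \<open>
  Identifying \<open>x\<close> and \<open>y\<close> when their ratio can be written as \<open>\<beta> / \<alpha>\<close> with \<open>\<alpha>\<close> and \<open>\<beta>\<close> bounded, equal and
  positive in the ring of differences, is a congruence. It does not identify \<open>1 + 1\<close> with \<open>1\<close>, as
  \<open>\<beta> = 2 \<alpha>\<close> would make \<open>\<alpha>\<close> vanish in that ring. By maximality it adds nothing to the given congruence,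
  so all such ratios are \<open>1\<close>.
\<close>

lemma stably_eq_imp_eq:
  assumes "a \<asymp> b" "stably_pos a" "bounded_above a" "bounded_above b"
  shows "a \<doteq> b"
proof -
  define F where "F x y \<longleftrightarrow> (\<exists>\<alpha> \<beta>. bounded_above \<alpha> \<and> bounded_above \<beta> \<and> stably_pos \<alpha> \<and> \<alpha> \<asymp> \<beta> \<and> \<alpha> * x \<doteq> \<beta> * y)" for x y
  have F_I: "F x y" if "bounded_above \<alpha>" "bounded_above \<beta>" "stably_pos \<alpha>" "\<alpha> \<asymp> \<beta>" "\<alpha> * x \<doteq> \<beta> * y" for x y \<alpha> \<beta>
    unfolding F_def using that by blast
  have F_eq: "F x y" if "x \<doteq> y" for x y
    by (rule F_I[of 1 1]) (use that in auto)
  have "semiring_congruence F"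
  proof (rule semiring_congruenceI)
    show "F x x" for x by (simp add: F_eq)
    show "F x y \<Longrightarrow> F y x" for x y
      unfolding F_def using stably_pos_cong stably_eq_sym eq_sym by blast
    show "F x z" if xy: "F x y" and yz: "F y z" for x y z
    proof -
      obtain \<alpha> \<beta> where ab: "bounded_above \<alpha>" "bounded_above \<beta>" "stably_pos \<alpha>" "\<alpha> \<asymp> \<beta>" "\<alpha> * x \<doteq> \<beta> * y"
        using xy unfolding F_def by blast
      obtain \<gamma> \<delta> where cd: "bounded_above \<gamma>" "bounded_above \<delta>" "stably_pos \<gamma>" "\<gamma> \<asymp> \<delta>" "\<gamma> * y \<doteq> \<delta> * z"
        using yz unfolding F_def by blast
      show ?thesis
      proof (rule F_I)
        show "bounded_above (\<alpha> * \<gamma>)" "bounded_above (\<beta> * \<delta>)" "stably_pos (\<alpha> * \<gamma>)"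
          using ab cd by (auto intro: bounded_above_mult stably_pos_mult)
        have "\<alpha> * \<gamma> \<asymp> \<beta> * \<gamma>"
          by (rule stably_eq_mult_right[OF ab(4) cd(1)])
        also have "\<beta> * \<gamma> \<asymp> \<beta> * \<delta>"
          using stably_eq_mult_right[OF cd(4) ab(2)] by (simp add: mult.commute)
        finally show "\<alpha> * \<gamma> \<asymp> \<beta> * \<delta>" .
        have "\<alpha> * \<gamma> * x = \<gamma> * (\<alpha> * x)"
          by (simp add: ac_simps)
        also have "\<dots> \<doteq> \<gamma> * (\<beta> * y)"
          by (rule mult_eq[OF eq_refl ab(5)])
        also have "\<dots> = \<beta> * (\<gamma> * y)"
          by (simp add: ac_simps)
        also have "\<dots> \<doteq> \<beta> * (\<delta> * z)"
          by (rule mult_eq[OF eq_refl cd(5)])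
        also have "\<dots> = \<beta> * \<delta> * z"
          by (simp add: ac_simps)
        finally show "\<alpha> * \<gamma> * x \<doteq> \<beta> * \<delta> * z" .
      qed
    qed
    show "F (x * z) (y * z)" if "F x y" for x y z
      using that unfolding F_def by (metis mult.assoc mult_eq eq_refl)
    show "F (x + z) (y + z)" if xy: "F x y" for x y z
    proof -
      obtain \<alpha> \<beta> where ab: "bounded_above \<alpha>" "bounded_above \<beta>" "stably_pos \<alpha>" "\<alpha> \<asymp> \<beta>" "\<alpha> * x \<doteq> \<beta> * y"
        using xy unfolding F_def by blast
      show ?thesis
      proof (cases "y + z \<doteq> 0")
        case True
        have y: "y \<doteq> 0"
          using True zerosumfree by blast
        have z: "z \<doteq> 0"
          using True zerosumfree[of z y] by (simp add: add.commute)
        have "\<alpha> * x \<doteq> 0"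
          using eq_trans[OF ab(5) mult_eq[OF eq_refl y]] by simp
        then have "x \<doteq> 0"
          using mult_nonzero stably_pos_nonzero[OF ab(3)] by blast
        then show ?thesis
          using y z by (intro F_eq) (meson add_eq eq_refl eq_sym eq_trans)
      next
        case False
        then obtain w where w: "(y + z) * w \<doteq> 1"
          using invertible by blast
        \<comment> \<open>With \<open>t + t' = 1\<close>, the ratio for the sums is the weighted mean of \<open>\<beta> / \<alpha>\<close> and \<open>1\<close>.\<close>
        define t t' where "t = y * w" and "t' = z * w"
        have tt: "t + t' \<doteq> 1"
          using w by (simp add: t_def t'_def distrib_right)
        have t_bd: "bounded_above t" "bounded_above t'"
          using le_eq_trans[OF le_add(1) tt] le_eq_trans[OF le_add(2) tt] bounded_above_le[OF _ bounded_above_1] by auto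
        show ?thesis
        proof (rule F_I)
          show "bounded_above \<alpha>" "bounded_above (\<beta> * t + \<alpha> * t')" "stably_pos \<alpha>"
            using ab t_bd by (auto intro: bounded_above_mult bounded_above_add)
          have "\<alpha> \<doteq> (t + t') * \<alpha>"
            using mult_eq[OF eq_sym[OF tt] eq_refl, of \<alpha>] by simp
          also have "\<dots> = \<alpha> * t + \<alpha> * t'"
            by (simp add: algebra_simps)
          finally have "\<alpha> \<asymp> \<alpha> * t + \<alpha> * t'"
            by (rule eq_imp_stably_eq)
          also have "\<alpha> * t + \<alpha> * t' \<asymp> \<beta> * t + \<alpha> * t'"
            by (intro stably_eq_add stably_eq_mult_right stably_eq_refl ab t_bd)
          finally show "\<alpha> \<asymp> \<beta> * t + \<alpha> * t'" .
          have "\<alpha> * (x + z) = \<alpha> * x + \<alpha> * z"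
            by (rule distrib_left)
          also have "\<dots> \<doteq> \<beta> * y + \<alpha> * z"
            by (rule add_eq[OF ab(5) eq_refl])
          also have "\<dots> \<doteq> (\<beta> * y + \<alpha> * z) * ((y + z) * w)"
            using mult_eq[OF eq_refl eq_sym[OF w], of "\<beta> * y + \<alpha> * z"] by simp
          also have "\<dots> = (\<beta> * t + \<alpha> * t') * (y + z)"
            by (simp add: t_def t'_def algebra_simps)
          finally show "\<alpha> * (x + z) \<doteq> (\<beta> * t + \<alpha> * t') * (y + z)" .
        qed
      qed
    qed
  qed
  moreover have "\<not> F (1 + 1) 1"
  proof
    assume "F (1 + 1) 1"
    then obtain \<alpha> \<beta> where ab: "bounded_above \<alpha>" "stably_pos \<alpha>" "\<alpha> \<asymp> \<beta>" "\<alpha> * (1 + 1) \<doteq> \<beta> * 1"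
      unfolding F_def by blast
    have "\<alpha> + \<alpha> \<asymp> \<beta>"
      using ab(4) by (intro eq_imp_stably_eq) (simp only: distrib_left mult_1_right)
    also have "\<beta> \<asymp> \<alpha> + 0"
      using stably_eq_sym[OF ab(3)] by simp
    finally have "\<alpha> + \<alpha> \<asymp> \<alpha> + 0" .
    then have "\<alpha> \<asymp> 0"
      by (rule stably_eq_cancel_left[OF ab(1)])
    then show False
      using stably_pos_cong[OF ab(2)] stably_pos_nonzero by blast
  qed
  moreover have "F b a"
    by (rule F_I[of a b]) (use assms in \<open>auto simp: mult.commute\<close>)
  ultimately show ?thesis
    using maximal F_eq eq_sym by blast
qed

text \<open>
  The inequality \<open>1 + 1 \<preceq> 1 + k s\<close> cannot be cancelled directly, but \<open>1 + (1 + c) = 1 + k s\<close> says that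
  \<open>1 + c\<close> and \<open>k s\<close> agree in the ring of differences, and so they are equal.
\<close>

lemma absorbed_or_bounded_below:
  assumes "s \<preceq> 1"
  shows "1 + s \<doteq> 1 \<or> bounded_below s"
proof (rule disjCI)
  assume "\<not> bounded_below s"
  show "1 + s \<doteq> 1"
  proof (rule ccontr)
    assume "\<not> 1 + s \<doteq> 1"
    then obtain k where k: "1 + 1 \<preceq> 1 + of_nat k * s"
      using absorbed_or_two_le assms by blast
    then obtain c where c: "1 + (1 + c) \<doteq> 1 + of_nat k * s"
      unfolding le_def add.assoc by blast
    have bd: "bounded_above (of_nat k * s)"
      using bounded_above_le[OF assms] by (simp add: bounded_above_mult)
    have "1 + c \<preceq> 1 + of_nat k * s"
      using le_eq_trans[OF le_add(2) c] .
    then have bd': "bounded_above (1 + c)"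
      by (rule bounded_above_le) (simp add: bd bounded_above_add)
    have pos: "stably_pos (of_nat k * s)"
      unfolding stably_pos_def using k by (intro exI[of _ 1]) simp
    have "of_nat k * s \<asymp> 1 + c"
      by (rule stably_eqI[OF bounded_above_1 eq_sym[OF c]])
    then have "of_nat k * s \<doteq> 1 + c"
      using pos bd bd' by (rule stably_eq_imp_eq)
    then have "1 \<preceq> of_nat k * s"
      using le_eq_trans[OF le_add(1) eq_sym] by blast
    then show False
      using \<open>\<not> bounded_below s\<close> unfolding bounded_below_def by blast
  qed
qed

text \<open>
  The dichotomy for elements below \<open>1\<close> is applied to \<open>x / (1 + x)\<close> and \<open>1 / (1 + x)\<close>. They cannot both be absorbed
  by \<open>1\<close>: their sum is \<open>1\<close>, and \<open>1 + 1\<close> is not.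
\<close>

lemma trichotomy:
  obtains "1 + x \<doteq> 1" | "x + 1 \<doteq> x" | "bounded_above x" "bounded_below x"
proof -
  have "\<not> 1 + x \<doteq> 0"
    using zerosumfree one_neq_zero by blast
  then obtain w where w: "(1 + x) * w \<doteq> 1"
    using invertible by blast
  have st: "w + x * w \<doteq> 1"
    using w by (simp add: distrib_right)
  have w_times: "w * (1 + x) \<doteq> 1"
    using w by (simp add: mult.commute)
  have le1: "w \<preceq> 1" "x * w \<preceq> 1"
    using le_eq_trans[OF le_add(1) st] le_eq_trans[OF le_add(2) st] .
  have above: "\<exists>k. 1 + x \<preceq> of_nat k" if "bounded_below w"
  proof -
    obtain k where "1 \<preceq> of_nat k * w"
      using \<open>bounded_below w\<close> unfolding bounded_below_def by blast
    from mult_right_le[OF this, of "1 + x"]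
    have "1 + x \<preceq> of_nat k * (w * (1 + x))"
      by (simp add: mult.assoc)
    also have "\<dots> \<doteq> of_nat k * 1"
      by (rule mult_eq[OF eq_refl w_times])
    finally show ?thesis
      by auto
  qed
  have below: "\<exists>k. 1 + x \<preceq> of_nat k * x" if "bounded_below (x * w)"
  proof -
    obtain k where "1 \<preceq> of_nat k * (x * w)"
      using \<open>bounded_below (x * w)\<close> unfolding bounded_below_def by blast
    from mult_right_le[OF this, of "1 + x"]
    have "1 + x \<preceq> of_nat k * x * (w * (1 + x))"
      by (simp add: mult.assoc)
    also have "\<dots> \<doteq> of_nat k * x * 1"
      by (rule mult_eq[OF eq_refl w_times])
    finally show ?thesis
      by auto
  qed
  consider (both) "1 + w \<doteq> 1" "1 + x * w \<doteq> 1"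
    | (small) "1 + x * w \<doteq> 1" "bounded_below w"
    | (large) "1 + w \<doteq> 1" "bounded_below (x * w)"
    | (finite) "bounded_below w" "bounded_below (x * w)"
    using absorbed_or_bounded_below le1 by blast
  then show ?thesis
  proof cases
    case both
    have "1 + 1 \<doteq> 1 + (w + x * w)"
      by (rule add_eq[OF eq_refl eq_sym[OF st]])
    also have "\<dots> = (1 + w) + x * w"
      by (simp add: ac_simps)
    also have "\<dots> \<doteq> 1 + x * w"
      by (rule add_eq[OF both(1) eq_refl])
    also have "\<dots> \<doteq> 1"
      by (rule both(2))
    finally show ?thesis
      using not_idempotent by blast
  next
    case small
    obtain k where k: "1 + x \<preceq> of_nat k"
      using above small(2) by blast
    have "x \<doteq> x * (w * (1 + x))"
      using mult_eq[OF eq_refl eq_sym[OF w_times], of x] by simp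
    also have "\<dots> = (1 + x) * (x * w)"
      by (simp add: ac_simps)
    also have "\<dots> \<preceq> of_nat k * (x * w)"
      by (rule mult_right_le[OF k])
    finally show ?thesis
      using that(1) absorb_le small(1) by blast
  next
    case large
    obtain k where k: "1 + x \<preceq> of_nat k * x"
      using below large(2) by blast
    have "1 \<doteq> (1 + x) * w"
      by (rule eq_sym[OF w])
    also have "\<dots> \<preceq> of_nat k * x * w"
      by (rule mult_right_le[OF k])
    finally have "1 \<preceq> of_nat k * (x * w)"
      by (simp add: mult.assoc)
    moreover have "x + x * w \<doteq> x"
      using mult_eq[OF eq_refl large(1), of x] by (simp add: distrib_left)
    ultimately show ?thesis
      using that(2) absorb_le by blast
  next
    case finite
    then show ?thesis
      using that(3) above[OF finite(1)] below[OF finite(2)] le_trans[OF le_add(2)] le_trans[OF le_add(1)]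
      unfolding bounded_above_def bounded_below_def by meson
  qed
qed

end

text \<open>
  A larger congruence that keeps \<open>1 + 1\<close> and \<open>1\<close> apart has the same zero class: an invertible element congruent to \<open>0\<close> would
  make \<open>1\<close> congruent to \<open>0\<close>, hence \<open>1 + 1\<close> to \<open>1\<close>. This is why the quotient stays a semifield with zero.
\<close>

lemma (in semifield_congruence) exists_maximal_congruence:
  "\<exists>E. (\<forall>x y. x \<doteq> y \<longrightarrow> E x y) \<and> maximal_semifield_congruence E"
proof -
  define C where "C = {r. semiring_congruence (\<lambda>x y. (x, y) \<in> r) \<and> {(x, y). x \<doteq> y} \<subseteq> r \<and> (1 + 1, 1) \<notin> r}"
  have "\<exists>M\<in>C. \<forall>K\<in>C. M \<subseteq> K \<longrightarrow> K = M"
  proof (rule subset_Zorn_nonempty)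
    have "{(x, y). x \<doteq> y} \<in> C"
      using congruence not_idempotent by (simp add: C_def)
    then show "C \<noteq> {}"
      by blast
    show "\<Union>\<C> \<in> C" if \<C>: "\<C> \<noteq> {}" "subset.chain C \<C>" for \<C>
    proof -
      have cong: "semiring_congruence (\<lambda>x y. (x, y) \<in> r)" if "r \<in> \<C>" for r
        using \<C>(2) that by (auto simp: subset.chain_def C_def)
      have "semiring_congruence (\<lambda>x y. (x, y) \<in> \<Union>\<C>)"
      proof (rule semiring_congruenceI)
        show "(x, x) \<in> \<Union>\<C>" for x
          using \<C>(1) cong unfolding semiring_congruence_def by (meson UnionI equivp_reflp ex_in_conv)
        show "(x, y) \<in> \<Union>\<C> \<Longrightarrow> (y, x) \<in> \<Union>\<C>" for x y
          using cong unfolding semiring_congruence_def by (meson UnionE UnionI equivp_symp)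
        show "(x, z) \<in> \<Union>\<C>" if xyz: "(x, y) \<in> \<Union>\<C>" "(y, z) \<in> \<Union>\<C>" for x y z
        proof -
          obtain r r' where r: "r \<in> \<C>" "(x, y) \<in> r" "r' \<in> \<C>" "(y, z) \<in> r'"
            using xyz by blast
          then have "r \<subseteq> r' \<or> r' \<subseteq> r"
            using \<C>(2) by (auto simp: subset.chain_def)
          then obtain r'' where "r'' \<in> \<C>" "(x, y) \<in> r''" "(y, z) \<in> r''"
            using r by blast
          then show ?thesis
            using cong unfolding semiring_congruence_def by (meson UnionI equivp_transp)
        qed
        show "(x, y) \<in> \<Union>\<C> \<Longrightarrow> (x + z, y + z) \<in> \<Union>\<C>" for x y z
          using cong unfolding semiring_congruence_def by blast
        show "(x, y) \<in> \<Union>\<C> \<Longrightarrow> (x * z, y * z) \<in> \<Union>\<C>" for x y z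
          using cong unfolding semiring_congruence_def by blast
      qed
      moreover have "{(x, y). x \<doteq> y} \<subseteq> \<Union>\<C>" "(1 + 1, 1) \<notin> \<Union>\<C>"
        using \<C> unfolding subset.chain_def C_def by blast+
      ultimately show ?thesis
        by (simp add: C_def)
    qed
  qed
  then obtain M where M: "M \<in> C" "\<And>K. K \<in> C \<Longrightarrow> M \<subseteq> K \<Longrightarrow> K = M"
    by blast
  define E where "E x y \<longleftrightarrow> (x, y) \<in> M" for x y
  have cong: "semiring_congruence E" and eq_E: "\<And>x y. x \<doteq> y \<Longrightarrow> E x y" and proper: "\<not> E (1 + 1) 1"
    using M(1) unfolding C_def E_def by auto
  have E_sym: "E x y \<Longrightarrow> E y x" and E_trans: "E x y \<Longrightarrow> E y z \<Longrightarrow> E x z"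
    and E_add: "E x y \<Longrightarrow> E (x + z) (y + z)" and E_mult: "E x y \<Longrightarrow> E (x * z) (y * z)" for x y z
    using cong unfolding semiring_congruence_def by (blast dest: equivp_symp equivp_transp)+
  have zero: "x \<doteq> 0" if "E x 0" for x
  proof (rule ccontr)
    assume "\<not> x \<doteq> 0"
    then obtain w where "x * w \<doteq> 1"
      using invertible by blast
    then have "E 1 (x * w)"
      using eq_E eq_sym by blast
    then have "E 1 0"
      using E_trans E_mult[OF \<open>E x 0\<close>, of w] by simp
    then show False
      using E_add[of 1 0 1] proper by simp
  qed
  have "maximal_semifield_congruence E"
  proof
    show "semiring_congruence E" by (rule cong)
    show "\<exists>y. E (x * y) 1" if "\<not> E x 0" for x
      using that eq_E invertible by blast
    show "E x 0" if "E (x + y) 0" for x y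
      using zero[OF that] zerosumfree eq_E by blast
    show "\<not> E (1 + 1) 1" by (rule proper)
    show "E x y" if F: "semiring_congruence F" "\<And>x y. E x y \<Longrightarrow> F x y" "\<not> F (1 + 1) 1" "F x y" for F x y
    proof -
      have "{(x, y). F x y} \<in> C"
        unfolding C_def using F eq_E by auto
      then have "{(x, y). F x y} = M"
        using F(2) by (intro M(2)) (auto simp: E_def)
      then show ?thesis
        using F(4) by (auto simp: E_def)
    qed
  qed
  then show ?thesis
    using eq_E by blast
qed

section \<open>Inverting primes modulo an ideal of a monoid ring\<close>

lemma nat_sequence_mono_subsequence:
  fixes g :: "nat \<Rightarrow> nat"
  shows "\<exists>r :: nat \<Rightarrow> nat. strict_mono r \<and> mono (\<lambda>i. g (r i))"
proof -
  obtain r :: "nat \<Rightarrow> nat" where r: "strict_mono r" "monoseq (\<lambda>i. g (r i))"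
    using seq_monosub[of g] by blast
  show ?thesis
  proof (cases "mono (\<lambda>i. g (r i))")
    case False
    then have dec: "g (r j) \<le> g (r i)" if "i \<le> j" for i j
      using r(2) that unfolding monoseq_def mono_def by blast
    obtain N where N: "\<And>n. g (r N) \<le> g (r n)"
      using ex_has_least_nat[of "\<lambda>_. True" 0 "\<lambda>n. g (r n)"] by auto
    have "g (r (i + N)) = g (r N)" for i
      using dec[of N "i + N"] N[of "i + N"] by simp
    then show ?thesis
      using r(1) by (intro exI[of _ "\<lambda>i. r (i + N)"]) (auto simp: strict_mono_def mono_def)
  qed (use r in blast)
qed

lemma multiset_sequence_mono_subsequence:
  fixes f :: "nat \<Rightarrow> 'a multiset"
  assumes "finite V"
  shows "\<exists>r :: nat \<Rightarrow> nat. strict_mono r \<and> (\<forall>v\<in>V. mono (\<lambda>i. count (f (r i)) v))"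
  using assms
proof (induction V)
  case empty
  show ?case by (auto intro: exI[of _ id] simp: strict_mono_def)
next
  case (insert v V)
  then obtain r :: "nat \<Rightarrow> nat" where r: "strict_mono r" "\<forall>v\<in>V. mono (\<lambda>i. count (f (r i)) v)"
    by blast
  obtain s :: "nat \<Rightarrow> nat" where s: "strict_mono s" "mono (\<lambda>i. count (f (r (s i))) v)"
    using nat_sequence_mono_subsequence[of "\<lambda>i. count (f (r i)) v"] by blast
  have "mono (\<lambda>i. count (f (r (s i))) u)" if "u \<in> V" for u
    using r(2) that strict_mono_mono[OF s(1)] by (auto simp: mono_def)
  moreover have "strict_mono (\<lambda>i. r (s i))"
    using r(1) s(1) by (simp add: strict_mono_def)
  ultimately show ?case
    using s(2) by (intro exI[of _ "\<lambda>i. r (s i)"]) auto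
qed

text \<open>
  The minimal elements of \<open>L\<close> serve as \<open>D\<close>. Infinitely many of them would give a sequence that is monotone in
  every coordinate along some subsequence, and two comparable minimal elements coincide.
\<close>

lemma dickson:
  assumes V: "finite V" and L: "\<And>a. a \<in> L \<Longrightarrow> set_mset a \<subseteq> V"
  obtains D where "finite D" "D \<subseteq> L" "\<And>a. a \<in> L \<Longrightarrow> \<exists>d\<in>D. d \<subseteq># a"
proof
  define D where "D = {d \<in> L. \<forall>e\<in>L. e \<subseteq># d \<longrightarrow> e = d}"
  show "D \<subseteq> L"
    by (auto simp: D_def)
  show "\<exists>d\<in>D. d \<subseteq># a" if "a \<in> L" for a
    using that
  proof (induction "size a" arbitrary: a rule: less_induct)
    case less
    show ?case
    proof (cases "a \<in> D")
      case False
      then obtain e where e: "e \<in> L" "e \<subseteq># a" "e \<noteq> a"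
        using less.prems by (auto simp: D_def)
      then have "size e < size a"
        by (simp add: mset_subset_size subset_mset.less_le)
      then show ?thesis
        using less.hyps e subset_mset.order_trans by blast
    qed auto
  qed
  show "finite D"
  proof (rule ccontr)
    assume "infinite D"
    then obtain f :: "nat \<Rightarrow> _" where f: "inj f" "range f \<subseteq> D"
      using infinite_countable_subset by blast
    obtain r :: "nat \<Rightarrow> nat" where r: "strict_mono r" "\<forall>v\<in>V. mono (\<lambda>i. count (f (r i)) v)"
      using multiset_sequence_mono_subsequence[OF V, of f] by blast
    have mem: "f (r i) \<in> D" for i
      using f(2) by auto
    have "count (f (r 0)) v \<le> count (f (r 1)) v" for v
    proof (cases "v \<in> V")
      case True
      then show ?thesis using r(2) by (auto simp: mono_def)
    next
      case False
      then have "v \<notin># f (r 0)"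
        using mem[of 0] L by (auto simp: D_def)
      then show ?thesis by (simp add: not_in_iff)
    qed
    then have "f (r 0) = f (r 1)"
      using mem[of 0] mem[of 1] by (auto simp: D_def subseteq_mset_def)
    then show False
      using f(1) r(1) by (metis inj_eq strict_mono_less less_irrefl zero_less_one)
  qed
qed

lemma poly_mapping_eq_sum_single:
  fixes z :: "'a \<Rightarrow>\<^sub>0 'b::comm_monoid_add"
  shows "z = (\<Sum>k\<in>Poly_Mapping.keys z. Poly_Mapping.single k (Poly_Mapping.lookup z k))"
  by (rule poly_mapping_eqI)
     (auto simp: Poly_Mapping.lookup_sum lookup_single when_def in_keys_iff)

lemma lookup_single_times:
  fixes z :: "'a::cancel_comm_monoid_add \<Rightarrow>\<^sub>0 'b::comm_semiring_1"
  shows "Poly_Mapping.lookup (Poly_Mapping.single a c * z) (a + b) = c * Poly_Mapping.lookup z b"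
proof -
  have "Poly_Mapping.single a c * z
      = (\<Sum>k\<in>Poly_Mapping.keys z. Poly_Mapping.single (a + k) (c * Poly_Mapping.lookup z k))"
    by (subst poly_mapping_eq_sum_single[of z]) (simp add: sum_distrib_left mult_single)
  then show ?thesis
    by (auto simp: Poly_Mapping.lookup_sum lookup_single when_def in_keys_iff)
qed

lemma keys_single_times:
  fixes z :: "'a::cancel_comm_monoid_add \<Rightarrow>\<^sub>0 'b::comm_semiring_1"
  shows "Poly_Mapping.keys (Poly_Mapping.single a c * z) \<subseteq> (+) a ` Poly_Mapping.keys z"
  using keys_mult[of "Poly_Mapping.single a c" z] by (auto split: if_splits)

text \<open>
  \<open>J\<close> is an ideal of the monoid ring \<open>\<int>[M]\<close>. The multiset order on exponents is a well-order compatible with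
  addition, so it serves as monomial order. By \<open>M_diff\<close>, divisibility of monomials inside \<open>M\<close> is the
  inclusion of multisets; hence Dickson's lemma gives finitely many elements of \<open>J\<close> whose leading monomials
  divide all leading monomials of \<open>J\<close>. If \<open>N\<close> is the product of their leading coefficients, every element is,
  after multiplication by a power of \<open>N\<close>, congruent to a combination of standard monomials (those not
  leading in \<open>J\<close>), and such a combination lies in \<open>J\<close> only if it is zero. The monomial \<open>1\<close> is standard. So
  if \<open>p z = 1\<close> modulo \<open>J\<close> and \<open>r\<close> is the normal form of \<open>N\<^sup>e z\<close>, then \<open>p r = N\<^sup>e\<close>, and \<open>p\<close> divides \<open>N\<close>.
\<close>

lemma finitely_many_primes_invertible:
  fixes J :: "(nat multiset \<Rightarrow>\<^sub>0 int) set" and M :: "nat multiset set"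
  assumes V: "finite V" and M_V: "\<And>a. a \<in> M \<Longrightarrow> set_mset a \<subseteq> V"
    and M_zero: "0 \<in> M" and M_add: "\<And>a b. a \<in> M \<Longrightarrow> b \<in> M \<Longrightarrow> a + b \<in> M"
    and M_diff: "\<And>a b. a \<in> M \<Longrightarrow> b \<in> M \<Longrightarrow> a \<subseteq># b \<Longrightarrow> b - a \<in> M"
    and J_keys: "\<And>z. z \<in> J \<Longrightarrow> Poly_Mapping.keys z \<subseteq> M"
    and J_zero: "0 \<in> J" and J_diff: "\<And>z w. z \<in> J \<Longrightarrow> w \<in> J \<Longrightarrow> z - w \<in> J"
    and J_shift: "\<And>a z. a \<in> M \<Longrightarrow> z \<in> J \<Longrightarrow> Poly_Mapping.single a 1 * z \<in> J"
    and J_const: "\<And>c. of_int c \<in> J \<Longrightarrow> c = 0"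
  shows "\<exists>N::int. N \<noteq> 0 \<and>
    (\<forall>p z. prime p \<longrightarrow> Poly_Mapping.keys z \<subseteq> M \<longrightarrow> of_int p * z - 1 \<in> J \<longrightarrow> p dvd N)"
proof -
  define lead where "lead z = Max (Poly_Mapping.keys z)" for z :: "nat multiset \<Rightarrow>\<^sub>0 int"
  have lead_key: "lead z \<in> Poly_Mapping.keys z" if "z \<noteq> 0" for z
    using that unfolding lead_def by (intro Max_in) auto
  have le_lead: "k \<le> lead z" if "k \<in> Poly_Mapping.keys z" for z k
    using that unfolding lead_def by simp
  define L where "L = lead ` (J - {0})"
  have L_M: "L \<subseteq> M"
    using lead_key J_keys unfolding L_def by blast
  obtain D where D: "finite D" "D \<subseteq> L" "\<And>a. a \<in> L \<Longrightarrow> \<exists>d\<in>D. d \<subseteq># a"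
    using dickson[OF V, of L] M_V L_M by blast
  have "\<forall>d\<in>D. \<exists>g. g \<in> J \<and> g \<noteq> 0 \<and> lead g = d"
    using D(2) unfolding L_def by auto
  then obtain g where g: "\<And>d. d \<in> D \<Longrightarrow> g d \<in> J \<and> g d \<noteq> 0 \<and> lead (g d) = d"
    by metis
  define N where "N = (\<Prod>d\<in>D. Poly_Mapping.lookup (g d) d)"
  have "Poly_Mapping.lookup (g d) d \<noteq> 0" if "d \<in> D" for d
    using g[OF that] lead_key[of "g d"] by (simp add: in_keys_iff)
  then have "N \<noteq> 0"
    using D(1) by (simp add: N_def)

  have J_uminus: "- z \<in> J" if "z \<in> J" for z
    using J_diff[OF J_zero that] by simp
  have J_add: "z + w \<in> J" if "z \<in> J" "w \<in> J" for z w
    using J_diff[OF that(1) J_uminus[OF that(2)]] by simp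
  have J_int: "of_int c * z \<in> J" if "z \<in> J" for c z
    by (induction c rule: int_induct[of _ 0])
       (auto simp: J_zero distrib_right left_diff_distrib J_add J_diff that)
  \<comment> \<open>The elements that have a normal form after multiplication by a power of \<open>N\<close>.\<close>
  define W where "W = {z. Poly_Mapping.keys z \<subseteq> M \<and>
    (\<exists>e r. Poly_Mapping.keys r \<subseteq> M - L \<and> of_int (N ^ e) * z - r \<in> J)}"
  have keys_int: "Poly_Mapping.keys (of_int c * z) \<subseteq> Poly_Mapping.keys z" for c :: int and z :: "nat multiset \<Rightarrow>\<^sub>0 int"
    using keys_single_times[of 0 c z] by (simp flip: single_of_int)
  have keys_diff: "Poly_Mapping.keys (z - w) \<subseteq> Poly_Mapping.keys z \<union> Poly_Mapping.keys w" for z w :: "nat multiset \<Rightarrow>\<^sub>0 int"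
    by (auto simp: in_keys_iff lookup_minus)
  have W_std: "z \<in> W" if "Poly_Mapping.keys z \<subseteq> M - L" for z
    unfolding W_def using that J_zero by (auto intro!: exI[of _ 0] exI[of _ z])
  have W_add: "z + w \<in> W" if zw: "z \<in> W" "w \<in> W" for z w
  proof -
    obtain e r where z: "Poly_Mapping.keys z \<subseteq> M" "Poly_Mapping.keys r \<subseteq> M - L" "of_int (N ^ e) * z - r \<in> J"
      using zw(1) unfolding W_def by blast
    obtain f s where w: "Poly_Mapping.keys w \<subseteq> M" "Poly_Mapping.keys s \<subseteq> M - L" "of_int (N ^ f) * w - s \<in> J"
      using zw(2) unfolding W_def by blast
    have "of_int (N ^ f) * (of_int (N ^ e) * z - r) + of_int (N ^ e) * (of_int (N ^ f) * w - s) \<in> J"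
      by (intro J_add J_int z w)
    also have "of_int (N ^ f) * (of_int (N ^ e) * z - r) + of_int (N ^ e) * (of_int (N ^ f) * w - s)
        = of_int (N ^ (e + f)) * (z + w) - (of_int (N ^ f) * r + of_int (N ^ e) * s)"
      by (simp add: algebra_simps power_add)
    finally have "of_int (N ^ (e + f)) * (z + w) - (of_int (N ^ f) * r + of_int (N ^ e) * s) \<in> J" .
    moreover have "Poly_Mapping.keys (of_int (N ^ f) * r + of_int (N ^ e) * s) \<subseteq> M - L"
      using Poly_Mapping.keys_add[of "of_int (N ^ f) * r" "of_int (N ^ e) * s"]
        keys_int[of "N ^ f" r] keys_int[of "N ^ e" s] z(2) w(2) by blast
    moreover have "Poly_Mapping.keys (z + w) \<subseteq> M"
      using Poly_Mapping.keys_add[of z w] z(1) w(1) by blast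
    ultimately show ?thesis
      unfolding W_def by blast
  qed
  have W_int: "of_int c * z \<in> W" if z: "z \<in> W" for c z
  proof -
    obtain e r where z: "Poly_Mapping.keys z \<subseteq> M" "Poly_Mapping.keys r \<subseteq> M - L" "of_int (N ^ e) * z - r \<in> J"
      using z unfolding W_def by blast
    have "of_int (N ^ e) * (of_int c * z) - of_int c * r \<in> J"
      using J_int[OF z(3), of c] by (simp add: algebra_simps)
    moreover have "Poly_Mapping.keys (of_int c * r) \<subseteq> M - L" "Poly_Mapping.keys (of_int c * z) \<subseteq> M"
      using keys_int[of c r] keys_int[of c z] z by auto
    ultimately show ?thesis
      unfolding W_def by blast
  qed
  have W_div: "z \<in> W" if z: "Poly_Mapping.keys z \<subseteq> M" "of_int N * z - w \<in> J" "w \<in> W" for z w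
  proof -
    obtain e r where w: "Poly_Mapping.keys r \<subseteq> M - L" "of_int (N ^ e) * w - r \<in> J"
      using z(3) unfolding W_def by blast
    have "of_int (N ^ e) * (of_int N * z - w) + (of_int (N ^ e) * w - r) \<in> J"
      by (intro J_add J_int z w)
    then have "of_int (N ^ Suc e) * z - r \<in> J"
      by (simp add: algebra_simps)
    then show ?thesis
      unfolding W_def using z(1) w(1) by blast
  qed
  have W_sum: "sum h A \<in> W" if "finite A" "\<And>k. k \<in> A \<Longrightarrow> h k \<in> W" for h and A :: "nat multiset set"
    using that by (induction A) (auto intro: W_add W_std)
  have W_lincomb: "z \<in> W" if "\<And>k. k \<in> Poly_Mapping.keys z \<Longrightarrow> Poly_Mapping.single k 1 \<in> W" for z
  proof -
    have "Poly_Mapping.single k c \<in> W" if "k \<in> Poly_Mapping.keys z" for k c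
      using W_int[OF \<open>\<And>k. k \<in> Poly_Mapping.keys z \<Longrightarrow> Poly_Mapping.single k 1 \<in> W\<close>[OF that], of c]
      by (simp add: mult_single flip: single_of_int)
    then have "(\<Sum>k\<in>Poly_Mapping.keys z. Poly_Mapping.single k (Poly_Mapping.lookup z k)) \<in> W"
      by (intro W_sum) auto
    then show ?thesis
      using poly_mapping_eq_sum_single[of z] by simp
  qed
  have W_monom: "Poly_Mapping.single a 1 \<in> W" if "a \<in> M" for a
    using that
  proof (induction a rule: less_induct)
    case (less a)
    show ?case
    proof (cases "a \<in> L")
      case False
      then show ?thesis
        using less.prems by (intro W_std) auto
    next
      case True
      then obtain d where d: "d \<in> D" "d \<subseteq># a"
        using D(3) by blast
      define b where "b = a - d"
      have a: "a = b + d"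
        using d(2) by (simp add: b_def)
      have b: "b \<in> M"
        using M_diff d L_M D(2) less.prems unfolding b_def by blast
      \<comment> \<open>One division step: \<open>h\<close> has leading term \<open>c x\<^sup>a\<close>, and \<open>t\<close> collects its lower terms with opposite sign.\<close>
      define h where "h = Poly_Mapping.single b 1 * g d"
      define c where "c = Poly_Mapping.lookup (g d) d"
      have h: "h \<in> J"
        unfolding h_def using J_shift b g d(1) by blast
      have lookup_h: "Poly_Mapping.lookup h a = c"
        unfolding h_def c_def a by (simp add: lookup_single_times)
      have keys_h: "k \<le> a" if k: "k \<in> Poly_Mapping.keys h" for k
      proof -
        obtain l where "k = b + l" "l \<in> Poly_Mapping.keys (g d)"
          using k keys_single_times[of b 1 "g d"] unfolding h_def by blast
        then show ?thesis
          using le_lead[of l "g d"] g[OF d(1)] unfolding a by (simp add: add_left_mono)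
      qed
      define t where "t = Poly_Mapping.single a c - h"
      have t: "k < a \<and> k \<in> M" if "k \<in> Poly_Mapping.keys t" for k
      proof -
        have "k \<noteq> a"
          using that lookup_h by (auto simp: t_def in_keys_iff lookup_minus)
        moreover have "k \<in> Poly_Mapping.keys h"
          using that \<open>k \<noteq> a\<close> by (simp add: t_def in_keys_iff lookup_minus lookup_single)
        ultimately show ?thesis
          using keys_h J_keys[OF h] by fastforce
      qed
      define q where "q = (\<Prod>d\<in>D - {d}. Poly_Mapping.lookup (g d) d)"
      have N: "N = q * c"
        unfolding N_def q_def c_def using D(1) d(1) by (subst prod.remove) (auto simp: mult.commute)
      have "of_int N * Poly_Mapping.single a 1 - of_int q * t = of_int q * h"
        by (simp add: t_def N right_diff_distrib mult_single flip: single_of_int)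
      then have "of_int N * Poly_Mapping.single a 1 - of_int q * t \<in> J"
        using J_int[OF h] by simp
      moreover have "of_int q * t \<in> W"
        by (rule W_int, rule W_lincomb, rule less.IH) (use t in auto)
      ultimately show ?thesis
        using less.prems by (intro W_div[of "Poly_Mapping.single a 1" "of_int q * t"]) auto
    qed
  qed

  have "0 \<notin> L"
  proof
    assume "0 \<in> L"
    then obtain z where z: "0 = lead z" "z \<in> J - {0}"
      unfolding L_def by (rule imageE)
    have "k = 0" if "k \<in> Poly_Mapping.keys z" for k
      using le_lead[OF that] unfolding z(1)[symmetric] by (metis less_eq_multiset_empty_right)
    then have "z = of_int (Poly_Mapping.lookup z 0)"
      by (intro poly_mapping_eqI) (auto simp: lookup_of_int when_def in_keys_iff)
    then show False
      using J_const z(2) by (metis DiffD1 DiffD2 of_int_0 singletonI)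
  qed

  show ?thesis
  proof (intro exI conjI allI impI)
    show "N \<noteq> 0" by fact
  next
    fix p :: int and z
    assume p: "prime p" and z: "Poly_Mapping.keys z \<subseteq> M" "of_int p * z - 1 \<in> J"
    have "z \<in> W"
      using W_lincomb W_monom z(1) by blast
    then obtain e r where r: "Poly_Mapping.keys r \<subseteq> M - L" "of_int (N ^ e) * z - r \<in> J"
      unfolding W_def by blast
    have "of_int p * (of_int (N ^ e) * z - r) - of_int (N ^ e) * (of_int p * z - 1) \<in> J"
      by (intro J_diff J_int z r)
    then have mem: "of_int (N ^ e) - of_int p * r \<in> J"
      by (simp add: algebra_simps)
    have std: "Poly_Mapping.keys (of_int (N ^ e) - of_int p * r) \<subseteq> M - L"
      using keys_diff[of "of_int (N ^ e)" "of_int p * r"] keys_int[of p r] keys_int[of "N ^ e" 1]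
        r(1) M_zero \<open>0 \<notin> L\<close> by auto
    have "of_int (N ^ e) - of_int p * r = 0"
    proof (rule ccontr)
      assume nonzero: "of_int (N ^ e) - of_int p * r \<noteq> 0"
      with mem have "lead (of_int (N ^ e) - of_int p * r) \<in> L"
        unfolding L_def by (intro imageI) simp
      then show False
        using subsetD[OF std lead_key[OF nonzero]] \<open>lead (of_int (N ^ e) - of_int p * r) \<in> L\<close> by (simp only: Diff_iff simp_thms)
    qed
    then have "of_int p * r = of_int (N ^ e)"
      by (simp only: right_minus_eq)
    then have "Poly_Mapping.lookup (of_int p * r) 0 = N ^ e"
      by (simp only: lookup_of_int when_simps simp_thms of_int_eq_id id_apply)
    then have "p * Poly_Mapping.lookup r 0 = N ^ e"
      using lookup_single_times[of 0 p r 0] by (simp flip: single_of_int)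
    then have "p dvd N ^ e"
      by (metis dvd_triv_left)
    then show "p dvd N"
      using p prime_dvd_power by blast
  qed
qed

section \<open>Finitely generated quotients\<close>

text \<open>
  A monomial in the generators \<open>x i\<close> is the multiset of its indices, so that multiplication of monomials
  becomes addition of multisets; a polynomial with natural coefficients is a multiset of monomials.
\<close>

definition monom_value :: "(nat \<Rightarrow> 'r::comm_semiring_1) \<Rightarrow> nat multiset \<Rightarrow> 'r" where
  "monom_value x a = (\<Prod>i\<in>#a. x i)"

definition poly_value :: "(nat \<Rightarrow> 'r::comm_semiring_1) \<Rightarrow> nat multiset multiset \<Rightarrow> 'r" where
  "poly_value x P = (\<Sum>a\<in>#P. monom_value x a)"

lemma monom_value_simps [simp]:
  "monom_value x 0 = 1" "monom_value x (a + b) = monom_value x a * monom_value x b"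
  by (simp_all add: monom_value_def)

lemma poly_value_simps [simp]:
  "poly_value x 0 = 0" "poly_value x (add_mset a P) = monom_value x a + poly_value x P"
  "poly_value x (P + Q) = poly_value x P + poly_value x Q"
  by (simp_all add: poly_value_def)

lemma poly_value_shift: "poly_value x (image_mset ((+) a) P) = monom_value x a * poly_value x P"
  by (induction P) (simp_all add: distrib_left)

lemma poly_value_repeat: "poly_value x (repeat_mset n P) = of_nat n * poly_value x P"
  by (induction n) (simp_all add: distrib_right)

lemma poly_value_mult:
  assumes "\<forall>a\<in>#P. set_mset a \<subseteq> V" "\<forall>a\<in>#Q. set_mset a \<subseteq> V"
  shows "\<exists>R. (\<forall>a\<in>#R. set_mset a \<subseteq> V) \<and> poly_value x R = poly_value x P * poly_value x Q"
  using assms(1)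
proof (induction P)
  case empty
  show ?case by (rule exI[of _ 0]) simp
next
  case (add a P)
  then obtain R where R: "\<forall>a\<in>#R. set_mset a \<subseteq> V" "poly_value x R = poly_value x P * poly_value x Q"
    by auto
  have "\<forall>b\<in>#image_mset ((+) a) Q + R. set_mset b \<subseteq> V"
    using add.prems assms(2) R(1) by (auto; blast)
  moreover have "poly_value x (image_mset ((+) a) Q + R) = poly_value x (add_mset a P) * poly_value x Q"
    by (simp add: R(2) poly_value_shift distrib_right)
  ultimately show ?case
    by blast
qed

definition formal_sum :: "nat multiset multiset \<Rightarrow> (nat multiset \<Rightarrow>\<^sub>0 int)" where
  "formal_sum P = (\<Sum>a\<in>#P. Poly_Mapping.single a 1)"

lemma formal_sum_simps [simp]:
  "formal_sum 0 = 0" "formal_sum (add_mset a P) = Poly_Mapping.single a 1 + formal_sum P"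
  "formal_sum (P + Q) = formal_sum P + formal_sum Q"
  by (simp_all add: formal_sum_def)

lemma lookup_formal_sum: "Poly_Mapping.lookup (formal_sum P) b = int (count P b)"
  by (induction P) (simp_all add: lookup_add lookup_single when_def)

lemma formal_sum_inject: "formal_sum P = formal_sum Q \<longleftrightarrow> P = Q"
  by (metis lookup_formal_sum multiset_eqI of_nat_eq_iff)

lemma formal_sum_shift: "formal_sum (image_mset ((+) a) P) = Poly_Mapping.single a 1 * formal_sum P"
  by (induction P) (simp_all add: distrib_left mult_single)

lemma formal_sum_repeat: "formal_sum (repeat_mset n P) = of_nat n * formal_sum P"
  by (induction n) (simp_all add: distrib_right)

lemma keys_formal_sum: "Poly_Mapping.keys (formal_sum P) = set_mset P"
  by (auto simp: in_keys_iff lookup_formal_sum)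

locale finitely_generated_maximal_congruence = maximal_semifield_congruence +
  fixes x :: "nat \<Rightarrow> 'a" and V :: "nat set"
  assumes finite_V: "finite V"
    and generated: "\<exists>P. (\<forall>a\<in>#P. set_mset a \<subseteq> V) \<and> r \<doteq> poly_value x P"
begin

definition finite_monoms :: "nat multiset set" where
  "finite_monoms = {a. set_mset a \<subseteq> V \<and> bounded_above (monom_value x a) \<and> bounded_below (monom_value x a)}"

lemma zero_finite_monom: "0 \<in> finite_monoms"
  unfolding finite_monoms_def bounded_below_def by (auto intro: exI[of _ 1])

text \<open>
  By the trichotomy, a monomial below the bounded element \<open>u\<close> is either infinitesimal, hence zero in the ring
  of differences, or bounded on both sides.
\<close>

lemma bounded_stably_eq_poly_value:
  assumes "bounded_above u"
  shows "\<exists>P. set_mset P \<subseteq> finite_monoms \<and> u \<asymp> poly_value x P"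
proof -
  have "\<exists>Q. set_mset Q \<subseteq> finite_monoms \<and> poly_value x P \<asymp> poly_value x Q"
    if "\<forall>a\<in>#P. set_mset a \<subseteq> V" "bounded_above (poly_value x P)" for P
    using that
  proof (induction P)
    case empty
    show ?case by (rule exI[of _ 0]) simp
  next
    case (add a P)
    let ?m = "monom_value x a"
    have bd: "bounded_above ?m" "bounded_above (poly_value x P)"
      using add.prems(2) bounded_above_le[OF le_add(1)[of ?m "poly_value x P"]]
        bounded_above_le[OF le_add(2)[of "poly_value x P" ?m]] by auto
    then obtain Q where Q: "set_mset Q \<subseteq> finite_monoms" "poly_value x P \<asymp> poly_value x Q"
      using add by auto
    show ?case
    proof (rule trichotomy[of ?m])
      assume "1 + ?m \<doteq> 1"
      then have "?m \<asymp> 0"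
        by (intro stably_eqI[OF bounded_above_1]) simp
      then show ?thesis
        using stably_eq_add[OF _ Q(2), of ?m 0] Q(1) by (intro exI[of _ Q]) simp
    next
      assume "?m + 1 \<doteq> ?m"
      then have "of_nat 1 \<asymp> of_nat 0"
        by (intro stably_eqI[OF bd(1)]) simp
      then show ?thesis
        by (simp only: of_nat_stably_eq_iff)
    next
      assume "bounded_above ?m" "bounded_below ?m"
      then have "set_mset (add_mset a Q) \<subseteq> finite_monoms"
        using Q(1) add.prems(1) by (simp add: finite_monoms_def)
      moreover have "poly_value x (add_mset a P) \<asymp> poly_value x (add_mset a Q)"
        using stably_eq_add[OF stably_eq_refl Q(2)] by simp
      ultimately show ?thesis
        by blast
    qed
  qed
  moreover obtain P where "\<forall>a\<in>#P. set_mset a \<subseteq> V" and P: "u \<doteq> poly_value x P"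
    using generated by blast
  moreover have "bounded_above (poly_value x P)"
    using bounded_above_le[OF eq_imp_le[OF eq_sym[OF P]] assms] .
  ultimately show ?thesis
    using stably_eq_trans[OF eq_imp_stably_eq[OF P]] by blast
qed

lemma bounded_above_poly_value: "set_mset P \<subseteq> finite_monoms \<Longrightarrow> bounded_above (poly_value x P)"
  by (induction P) (auto simp: finite_monoms_def bounded_above_add)

text \<open>
  The kernel of the map from the monoid ring of \<open>finite_monoms\<close> to the ring of differences. Writing its
  elements as differences of multisets avoids choosing a value for negative coefficients.
\<close>

definition relations :: "(nat multiset \<Rightarrow>\<^sub>0 int) set" where
  "relations = {formal_sum P - formal_sum Q | P Q.
     set_mset P \<subseteq> finite_monoms \<and> set_mset Q \<subseteq> finite_monoms \<and> poly_value x P \<asymp> poly_value x Q}"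

lemma relationsI:
  "set_mset P \<subseteq> finite_monoms \<Longrightarrow> set_mset Q \<subseteq> finite_monoms \<Longrightarrow> poly_value x P \<asymp> poly_value x Q
    \<Longrightarrow> formal_sum P - formal_sum Q \<in> relations"
  unfolding relations_def by blast

lemma of_nat_not_relation:
  assumes "set_mset P \<subseteq> finite_monoms" "set_mset Q \<subseteq> finite_monoms" "poly_value x P \<asymp> poly_value x Q"
    and "formal_sum P = formal_sum Q + of_nat n"
  shows "n = 0"
proof -
  have one: "formal_sum {#0#} = 1" "poly_value x {#0#} = 1"
    by simp_all
  have "formal_sum P = formal_sum (repeat_mset n {#0#} + Q)"
    by (simp only: assms(4) formal_sum_simps(3) formal_sum_repeat one mult_1_right add.commute)
  then have "P = repeat_mset n {#0#} + Q"
    by (simp only: formal_sum_inject)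
  then have "poly_value x P = poly_value x Q + of_nat n"
    by (simp only: poly_value_simps(3) poly_value_repeat one mult_1_right add.commute)
  then have "poly_value x Q + of_nat n \<asymp> poly_value x Q + of_nat 0"
    using assms(3) by simp
  then show ?thesis
    using stably_eq_cancel_left[OF bounded_above_poly_value[OF assms(2)]] of_nat_stably_eq_iff by blast
qed

text \<open>
  The class of \<open>1/p\<close> is bounded by \<open>1\<close>, so it is represented by some polynomial \<open>z\<close> in the finite monomials, and
  \<open>p z - 1\<close> is a relation. No nonzero integer is a relation, so only finitely many primes \<open>p\<close> can occur.
\<close>

lemma contradiction: False
proof -
  let ?M = finite_monoms
  have diff_eq: "(formal_sum P - formal_sum Q) - (formal_sum P' - formal_sum Q')
      = formal_sum (P + Q') - formal_sum (Q + P')" for P Q P' Q'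
    by simp
  have "\<exists>N::int. N \<noteq> 0 \<and>
    (\<forall>p z. prime p \<longrightarrow> Poly_Mapping.keys z \<subseteq> ?M \<longrightarrow> of_int p * z - 1 \<in> relations \<longrightarrow> p dvd N)"
  proof (rule finitely_many_primes_invertible[OF finite_V, where M = ?M and J = relations])
    show "set_mset a \<subseteq> V" if "a \<in> ?M" for a
      using that by (simp add: finite_monoms_def)
    show "0 \<in> ?M" by (rule zero_finite_monom)
    show "a + b \<in> ?M" if "a \<in> ?M" "b \<in> ?M" for a b
      using that by (auto simp: finite_monoms_def bounded_above_mult bounded_below_mult)
    show "b - a \<in> ?M" if a: "a \<in> ?M" and b: "b \<in> ?M" and ab: "a \<subseteq># b" for a b
    proof -
      have "monom_value x b = monom_value x a * monom_value x (b - a)"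
        using subset_mset.add_diff_inverse[OF ab] monom_value_simps(2) by metis
      moreover have "set_mset (b - a) \<subseteq> set_mset b"
        by (meson in_diffD subsetI)
      ultimately show ?thesis
        using a b bounded_above_factor bounded_below_factor unfolding finite_monoms_def by auto
    qed
    show "Poly_Mapping.keys z \<subseteq> ?M" if "z \<in> relations" for z
      using that by (auto simp: relations_def in_keys_iff lookup_minus lookup_formal_sum)
        (metis count_inI subsetD)+
    show "0 \<in> relations"
      using relationsI[of 0 0] by simp
    show "z - w \<in> relations" if z: "z \<in> relations" and w: "w \<in> relations" for z w
    proof -
      obtain P Q where P: "set_mset P \<subseteq> ?M" "set_mset Q \<subseteq> ?M" "poly_value x P \<asymp> poly_value x Q"
          and z_eq: "z = formal_sum P - formal_sum Q"
        using z unfolding relations_def by blast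
      obtain P' Q' where P': "set_mset P' \<subseteq> ?M" "set_mset Q' \<subseteq> ?M" "poly_value x P' \<asymp> poly_value x Q'"
          and w_eq: "w = formal_sum P' - formal_sum Q'"
        using w unfolding relations_def by blast
      show ?thesis
        unfolding z_eq w_eq diff_eq
        using P P' stably_eq_add[OF P(3) stably_eq_sym[OF P'(3)]] by (intro relationsI) auto
    qed
    show "Poly_Mapping.single a 1 * z \<in> relations" if a: "a \<in> ?M" and z: "z \<in> relations" for a z
    proof -
      obtain P Q where P: "set_mset P \<subseteq> ?M" "set_mset Q \<subseteq> ?M" "poly_value x P \<asymp> poly_value x Q"
          and z_eq: "z = formal_sum P - formal_sum Q"
        using z unfolding relations_def by blast
      have shift: "set_mset (image_mset ((+) a) R) \<subseteq> ?M" if "set_mset R \<subseteq> ?M" for R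
        using that a by (auto simp: finite_monoms_def bounded_above_mult bounded_below_mult subset_iff)
      have "bounded_above (monom_value x a)"
        using a by (simp add: finite_monoms_def)
      then have "poly_value x (image_mset ((+) a) P) \<asymp> poly_value x (image_mset ((+) a) Q)"
        using stably_eq_mult_right[OF P(3)] by (simp add: poly_value_shift mult.commute)
      then show ?thesis
        unfolding z_eq right_diff_distrib formal_sum_shift[symmetric]
        by (intro relationsI shift P)
    qed
    show "c = 0" if c_rel: "of_int c \<in> relations" for c
    proof -
      obtain P Q where P: "set_mset P \<subseteq> ?M" "set_mset Q \<subseteq> ?M" "poly_value x P \<asymp> poly_value x Q"
          and c: "of_int c = formal_sum P - formal_sum Q"
        using c_rel unfolding relations_def by blast
      show ?thesis
      proof (cases "c \<ge> 0")
        case True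
        then have "formal_sum P = formal_sum Q + of_nat (nat c)"
          using c by (simp add: algebra_simps)
        then have "nat c = 0"
          by (rule of_nat_not_relation[OF P])
        then show ?thesis
          using True by simp
      next
        case False
        then have "formal_sum Q = formal_sum P + of_nat (nat (- c))"
          using c by (simp add: algebra_simps)
        then have "nat (- c) = 0"
          by (rule of_nat_not_relation[OF P(2,1) stably_eq_sym[OF P(3)]])
        then show ?thesis
          using False by simp
      qed
    qed
  qed
  then obtain N :: int where N: "N \<noteq> 0"
    "\<And>p z. prime p \<Longrightarrow> Poly_Mapping.keys z \<subseteq> ?M \<Longrightarrow> of_int p * z - 1 \<in> relations \<Longrightarrow> p dvd N"
    by blast
  obtain p :: nat where p: "prime p" "nat \<bar>N\<bar> < p"
    using bigger_prime by blast
  have "p > 0"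
    using p(1) by (rule prime_gt_0_nat)
  then obtain u where u: "of_nat p * u \<doteq> 1"
    using invertible of_nat_nonzero by blast
  have "u \<preceq> u + of_nat (p - 1) * u"
    by (rule le_add)
  also have "\<dots> = of_nat p * u"
    using \<open>p > 0\<close> by (cases p) (simp_all add: distrib_right)
  also have "\<dots> \<doteq> 1"
    by (rule u)
  finally have "bounded_above u"
    by (rule bounded_above_le) simp
  then obtain P where P: "set_mset P \<subseteq> ?M" "u \<asymp> poly_value x P"
    using bounded_stably_eq_poly_value by blast
  have "poly_value x (repeat_mset p P) = poly_value x P * of_nat p"
    by (simp add: poly_value_repeat mult.commute)
  also have "\<dots> \<asymp> u * of_nat p"
    by (rule stably_eq_mult_right[OF stably_eq_sym[OF P(2)]]) simp
  also have "\<dots> \<asymp> poly_value x {#0#}"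
    using eq_imp_stably_eq[OF u] by (simp add: mult.commute)
  finally have "poly_value x (repeat_mset p P) \<asymp> poly_value x {#0#}" .
  moreover have "set_mset (repeat_mset p P) \<subseteq> set_mset P"
    by (induction p) auto
  then have "set_mset (repeat_mset p P) \<subseteq> ?M" "set_mset {#0#} \<subseteq> ?M"
    using P(1) zero_finite_monom by auto
  ultimately have "formal_sum (repeat_mset p P) - formal_sum {#0#} \<in> relations"
    by (intro relationsI)
  then have "of_int (int p) * formal_sum P - 1 \<in> relations"
    by (simp add: formal_sum_repeat)
  then have "int p dvd N"
    using N(2)[of "int p" "formal_sum P"] p(1) P(1) by (simp add: keys_formal_sum)
  then show False
    using p(2) N(1) zdvd_imp_le[of "int p" "\<bar>N\<bar>"] by auto
qed

end

section \<open>The free commutative semiring\<close>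

text \<open>
  The free commutative semiring is built from terms because a term can be evaluated in a semiring without
  zero by recursion alone, with \<^const>\<open>None\<close> as the adjoined zero.
\<close>

datatype sr_term = Var nat | Zero | One | Plus sr_term sr_term | Times sr_term sr_term

inductive sr_eq :: "sr_term \<Rightarrow> sr_term \<Rightarrow> bool" where
  refl: "sr_eq s s"
| sym: "sr_eq s t \<Longrightarrow> sr_eq t s"
| trans: "sr_eq s t \<Longrightarrow> sr_eq t u \<Longrightarrow> sr_eq s u"
| Plus_cong: "sr_eq s s' \<Longrightarrow> sr_eq t t' \<Longrightarrow> sr_eq (Plus s t) (Plus s' t')"
| Times_cong: "sr_eq s s' \<Longrightarrow> sr_eq t t' \<Longrightarrow> sr_eq (Times s t) (Times s' t')"
| Plus_assoc: "sr_eq (Plus (Plus s t) u) (Plus s (Plus t u))"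
| Plus_commute: "sr_eq (Plus s t) (Plus t s)"
| Plus_Zero: "sr_eq (Plus Zero s) s"
| Times_assoc: "sr_eq (Times (Times s t) u) (Times s (Times t u))"
| Times_commute: "sr_eq (Times s t) (Times t s)"
| Times_One: "sr_eq (Times One s) s"
| Times_Zero: "sr_eq (Times Zero s) Zero"
| Times_Plus: "sr_eq (Times (Plus s t) u) (Plus (Times s u) (Times t u))"

text \<open>
  Evaluation in \<open>\<nat>\<close>, which separates \<^const>\<open>Zero\<close> from \<^const>\<open>One\<close>.
\<close>

primrec nat_eval :: "sr_term \<Rightarrow> nat" where
  "nat_eval (Var i) = 0"
| "nat_eval Zero = 0"
| "nat_eval One = 1"
| "nat_eval (Plus s t) = nat_eval s + nat_eval t"
| "nat_eval (Times s t) = nat_eval s * nat_eval t"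

lemma sr_eq_nat_eval: "sr_eq s t \<Longrightarrow> nat_eval s = nat_eval t"
  by (induction rule: sr_eq.induct) (simp_all add: algebra_simps)

quotient_type free_semiring = sr_term / sr_eq
  by (intro equivpI reflpI sympI transpI) (auto intro: sr_eq.refl sr_eq.sym sr_eq.trans)

instantiation free_semiring :: comm_semiring_1
begin

lift_definition zero_free_semiring :: free_semiring is Zero .
lift_definition one_free_semiring :: free_semiring is One .
lift_definition plus_free_semiring :: "free_semiring \<Rightarrow> free_semiring \<Rightarrow> free_semiring" is Plus
  by (rule sr_eq.Plus_cong)
lift_definition times_free_semiring :: "free_semiring \<Rightarrow> free_semiring \<Rightarrow> free_semiring" is Times
  by (rule sr_eq.Times_cong)

instance
proof
  fix a b c :: free_semiring
  show "a + b + c = a + (b + c)" by transfer (rule sr_eq.Plus_assoc)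
  show "a + b = b + a" by transfer (rule sr_eq.Plus_commute)
  show "0 + a = a" by transfer (rule sr_eq.Plus_Zero)
  show "a * b * c = a * (b * c)" by transfer (rule sr_eq.Times_assoc)
  show "a * b = b * a" by transfer (rule sr_eq.Times_commute)
  show "1 * a = a" by transfer (rule sr_eq.Times_One)
  show "0 * a = 0" by transfer (rule sr_eq.Times_Zero)
  show "(a + b) * c = a * c + b * c" by transfer (rule sr_eq.Times_Plus)
  show "a * 0 = 0" by transfer (rule sr_eq.trans[OF sr_eq.Times_commute sr_eq.Times_Zero])
  show "(0::free_semiring) \<noteq> 1" by transfer (auto dest: sr_eq_nat_eval)
qed

end

lift_definition var :: "nat \<Rightarrow> free_semiring" is Var .

fun option_add :: "('a \<Rightarrow> 'a \<Rightarrow> 'a) \<Rightarrow> 'a option \<Rightarrow> 'a option \<Rightarrow> 'a option" where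
  "option_add f None y = y"
| "option_add f (Some a) None = Some a"
| "option_add f (Some a) (Some b) = Some (f a b)"

fun option_mul :: "('a \<Rightarrow> 'a \<Rightarrow> 'a) \<Rightarrow> 'a option \<Rightarrow> 'a option \<Rightarrow> 'a option" where
  "option_mul f (Some a) (Some b) = Some (f a b)"
| "option_mul f _ _ = None"

locale semiring_evaluation = comm_semiring_on S sadd smul
  for S :: "'a set" and sadd smul +
  fixes e :: 'a and f :: "nat \<Rightarrow> 'a"
  assumes unit_closed: "e \<in> S" and unit: "x \<in> S \<Longrightarrow> smul e x = x"
    and f_closed: "f i \<in> S"
begin

primrec eval :: "sr_term \<Rightarrow> 'a option" where
  "eval (Var i) = Some (f i)"
| "eval Zero = None"
| "eval One = Some e"
| "eval (Plus s t) = option_add sadd (eval s) (eval t)"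
| "eval (Times s t) = option_mul smul (eval s) (eval t)"

lemma eval_closed: "eval t = Some a \<Longrightarrow> a \<in> S"
proof (induction t arbitrary: a)
  case (Plus s t)
  then show ?case
    by (cases "eval s"; cases "eval t") (auto simp: add_closed)
next
  case (Times s t)
  then show ?case
    by (cases "eval s"; cases "eval t") (auto simp: mul_closed)
qed (auto simp: f_closed unit_closed)

lemma sum_mul_distrib:
  "x \<in> S \<Longrightarrow> y \<in> S \<Longrightarrow> z \<in> S \<Longrightarrow> smul (sadd x y) z = sadd (smul x z) (smul y z)"
  using distrib[of z x y] by (simp add: add_closed mul_commute)

lemma sr_eq_eval: "sr_eq s t \<Longrightarrow> eval s = eval t"
proof (induction rule: sr_eq.induct)
  case (Plus_assoc s t u)
  show ?case
    by (cases "eval s"; cases "eval t"; cases "eval u") (auto simp: add_assoc eval_closed)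
next
  case (Plus_commute s t)
  show ?case
    by (cases "eval s"; cases "eval t") (auto simp: add_commute eval_closed)
next
  case (Times_assoc s t u)
  show ?case
    by (cases "eval s"; cases "eval t"; cases "eval u") (auto simp: mul_assoc eval_closed)
next
  case (Times_commute s t)
  show ?case
    by (cases "eval s"; cases "eval t") (auto simp: mul_commute eval_closed)
next
  case (Times_One s)
  show ?case
    by (cases "eval s") (auto simp: unit eval_closed)
next
  case (Times_Plus s t u)
  show ?case
    by (cases "eval s"; cases "eval t"; cases "eval u")
       (auto simp: sum_mul_distrib eval_closed)
qed auto

definition sr_value :: "free_semiring \<Rightarrow> 'a option" where
  "sr_value x = eval (rep_free_semiring x)"

lemma sr_value_abs: "sr_value (abs_free_semiring t) = eval t"
  unfolding sr_value_def
  by (rule sr_eq_eval) (simp add: Quotient3_rep_abs[OF Quotient3_free_semiring] sr_eq.refl)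

lemma sr_value_simps [simp]:
  "sr_value 0 = None" "sr_value 1 = Some e" "sr_value (var i) = Some (f i)"
  "sr_value (x + y) = option_add sadd (sr_value x) (sr_value y)"
  "sr_value (x * y) = option_mul smul (sr_value x) (sr_value y)"
proof -
  show "sr_value 0 = None" "sr_value 1 = Some e" "sr_value (var i) = Some (f i)"
    by (simp_all add: zero_free_semiring.abs_eq one_free_semiring.abs_eq var.abs_eq sr_value_abs)
  obtain s t where "x = abs_free_semiring s" "y = abs_free_semiring t"
    by (metis Quotient3_abs_rep[OF Quotient3_free_semiring])
  then show "sr_value (x + y) = option_add sadd (sr_value x) (sr_value y)"
    "sr_value (x * y) = option_mul smul (sr_value x) (sr_value y)"
    by (simp_all add: plus_free_semiring.abs_eq times_free_semiring.abs_eq sr_value_abs)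
qed

lemma sr_value_closed: "sr_value x = Some a \<Longrightarrow> a \<in> S"
  unfolding sr_value_def by (rule eval_closed)

end


section \<open>Finitely generated semifields\<close>

theorem finitely_generated_semifield_idempotent:
  assumes semifield: "semifield_on S sadd smul"
    and fin_gen: "finitely_generated_semiring S sadd smul"
  shows "additively_idempotent S sadd"
proof -
  interpret semifield_on S sadd smul
    by (rule semifield)
  obtain e where "group \<lparr>carrier = S, monoid.mult = smul, one = e\<rparr>" (is "group ?G")
    using mul_group by blast
  then interpret G: group ?G .
  have unit: "smul e a = a" if "a \<in> S" for a
    using G.l_one[of a] that by simp
  have e: "e \<in> S"
    using G.one_closed by simp
  have inverse: "\<exists>b\<in>S. smul a b = e" if "a \<in> S" for a
    using G.inv_closed[of a] G.r_inv[of a] that by auto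
  have "sadd e e = e"
  proof (rule ccontr)
    assume not_idem: "sadd e e \<noteq> e"
    obtain F where F: "finite F" "F \<subseteq> S" "semiring_span sadd smul F = S"
      using fin_gen unfolding finitely_generated_semiring_def by blast
    obtain n :: nat and g where g: "F = g ` {i. i < n}"
      using finite_imp_nat_seg_image_inj_on[OF F(1)] by blast
    \<comment> \<open>Surplus variables are sent to the unit, so that every variable has a value in \<open>S\<close>.\<close>
    define f where "f i = (if i < n then g i else e)" for i
    interpret semiring_evaluation S sadd smul e f
    proof
      show "e \<in> S" by (rule e)
      show "smul e a = a" if "a \<in> S" for a by (rule unit[OF that])
      show "f i \<in> S" for i
        using F(2) e by (auto simp: f_def g)
    qed
    have onto: "\<exists>P. (\<forall>a\<in>#P. set_mset a \<subseteq> {..<n}) \<and> sr_value (poly_value var P) = Some s"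
      if "s \<in> S" for s
      using that unfolding F(3)[symmetric]
    proof (induction rule: semiring_span.induct)
      case (base s)
      then obtain i where "i < n" "s = f i"
        by (auto simp: g f_def)
      then show ?case
        by (intro exI[of _ "{#{#i#}#}"]) (simp add: poly_value_def monom_value_def)
    next
      case (add s t)
      then obtain P Q where "\<forall>a\<in>#P. set_mset a \<subseteq> {..<n}" "sr_value (poly_value var P) = Some s"
          "\<forall>a\<in>#Q. set_mset a \<subseteq> {..<n}" "sr_value (poly_value var Q) = Some t"
        by blast
      then show ?case
        by (intro exI[of _ "P + Q"]) auto
    next
      case (mul s t)
      then obtain P Q where P: "\<forall>a\<in>#P. set_mset a \<subseteq> {..<n}" "sr_value (poly_value var P) = Some s"
          and Q: "\<forall>a\<in>#Q. set_mset a \<subseteq> {..<n}" "sr_value (poly_value var Q) = Some t"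
        by blast
      obtain R where "\<forall>a\<in>#R. set_mset a \<subseteq> {..<n}"
          "poly_value var R = poly_value var P * poly_value var Q"
        using poly_value_mult[OF P(1) Q(1)] by blast
      then show ?case
        using P(2) Q(2) by (intro exI[of _ R]) simp
    qed
    define eq where "eq x y \<longleftrightarrow> sr_value x = sr_value y" for x y
    interpret eq: semifield_congruence eq
    proof
      show "semiring_congruence eq"
        by (rule semiring_congruenceI) (simp_all add: eq_def)
      show "\<exists>y. eq (x * y) 1" if x: "\<not> eq x 0" for x
      proof -
        obtain a where a: "sr_value x = Some a"
          using x by (auto simp: eq_def)
        obtain b where b: "b \<in> S" "smul a b = e"
          using inverse sr_value_closed[OF a] by blast
        obtain P where "sr_value (poly_value var P) = Some b"
          using onto[OF b(1)] by blast
        then show ?thesis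
          using a b(2) by (intro exI[of _ "poly_value var P"]) (simp add: eq_def)
      qed
      show "eq x 0" if "eq (x + y) 0" for x y
        using that by (cases "sr_value x"; cases "sr_value y") (simp_all add: eq_def)
      show "\<not> eq (1 + 1) 1"
        using not_idem unfolding eq_def sr_value_simps option_add.simps by simp
    qed
    obtain E where E: "\<And>x y. eq x y \<Longrightarrow> E x y" "maximal_semifield_congruence E"
      using eq.exists_maximal_congruence by blast
    interpret E: maximal_semifield_congruence E
      by (rule E(2))
    interpret E: finitely_generated_maximal_congruence E var "{..<n}"
    proof
      show "finite {..<n}" by simp
      show "\<exists>P. (\<forall>a\<in>#P. set_mset a \<subseteq> {..<n}) \<and> E x (poly_value var P)" for x
      proof (cases "sr_value x")
        case None
        then have "eq x (poly_value var 0)"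
          by (simp add: eq_def)
        show ?thesis
          using E(1)[OF \<open>eq x (poly_value var 0)\<close>] by (intro exI[of _ 0]) simp
      next
        case (Some s)
        obtain P where P: "\<forall>a\<in>#P. set_mset a \<subseteq> {..<n}" "sr_value (poly_value var P) = Some s"
          using onto[OF sr_value_closed[OF Some]] by blast
        have "E x (poly_value var P)"
          by (rule E(1)) (simp add: eq_def Some P(2))
        with P(1) show ?thesis
          by blast
      qed
    qed
    show False
      by (rule E.contradiction)
  qed
  show ?thesis
    unfolding additively_idempotent_def
  proof
    fix a assume a: "a \<in> S"
    then have "sadd a a = sadd (smul a e) (smul a e)"
      using unit mul_commute e by simp
    also have "\<dots> = smul a (sadd e e)"
      using distrib[OF a e e] by simp
    also have "\<dots> = a"
      using \<open>sadd e e = e\<close> unit[OF a] mul_commute[OF a e] by simp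
    finally show "sadd a a = a" .
  qed
qed

theorem theorem3p1:
  fixes S :: "'a set" and sadd smul :: "'a \<Rightarrow> 'a \<Rightarrow> 'a"
  assumes no_such_B_I:
    "\<nexists>(n :: nat) (B :: int_mpoly set) (I :: int_mpoly set).
       n > 0 \<and>
       subring B (int_poly_ring n) \<and>
       ideal I ((int_poly_ring n)\<lparr>carrier := B\<rparr>) \<and>
       quotient_field B = rational_functions n \<and>
       genideal (int_poly_ring n) I = carrier (int_poly_ring n) \<and>
       (\<exists>l0\<in>pos_polys n. \<forall>a\<in>pos_polys n.
          \<forall>h\<in>polys_over B. poly h (l0 + a) = 0 \<longrightarrow> h \<in> polys_over I) \<and>
       contains_rationals ((int_poly_ring n)\<lparr>carrier := B\<rparr> Quot I)"
    and semifield: "semifield_on S sadd smul"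
    and fin_gen: "finitely_generated_semiring S sadd smul"
  shows "additively_idempotent S sadd"
  using semifield fin_gen by (rule finitely_generated_semifield_idempotent)

end
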